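(* For every integer $a\ge 3$, the topological boundary $\partial\mathcal{R}_a$ of the Rauzy fractal $\mathcal{R}_a\subset\mathbb{C}$ is homeomorphic to the unit circle $S^1$.
   Context: Let $a\ge 3$ be an integer. The polynomial $x^3-ax^2+x-1$ factors as $(x-\beta)(x-\alpha)(x-\overline{\alpha})$ with $\beta>1$ real and $\alpha,\overline{\alpha}\in\mathbb{C}\setminus\mathbb{R}$, $|\alpha|<1$; fix such an $\alpha$. The Rauzy fractal is $$\mathcal{R}_a=\Big\{\sum_{i=2}^{\infty}a_i\alpha^i\Big\},$$ where $(a_i)_{i\ge 2}$ runs over all sequences with $a_i\in\{0,1,\dots,a-1\}$ such that, putting $a_i=0$ for $i<2$, the word $a_ia_{i-1}a_{i-2}a_{i-3}$ is strictly smaller than the word $(a-1)(a-1)01$ in the lexicographic order for all $i\ge 2$. *)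

theory Defs
  imports "HOL-Analysis.Analysis" "HOL-Computational_Algebra.Polynomial"
begin

definition rauzy_poly :: "nat \<Rightarrow> complex poly" where
  "rauzy_poly a = [:-1, 1, - of_nat a, 1:]"

(* The existence lemma below shows that these conditions are satisfiable for every a \<ge> 3. *)
definition rauzy_roots :: "nat \<Rightarrow> real \<Rightarrow> complex \<Rightarrow> bool" where
  "rauzy_roots a \<beta> \<alpha> \<longleftrightarrow>
     rauzy_poly a = [:- of_real \<beta>, 1:] * [:- \<alpha>, 1:] * [:- cnj \<alpha>, 1:] \<and>
     1 < \<beta> \<and> \<alpha> \<notin> \<real> \<and> norm \<alpha> < 1"

(* Digit sequences are indexed by all integers, so that the padding d i = 0 for i < 2
   covers d (-1), which occurs in the word at i = 2. *)
definition rauzy_admissible :: "nat \<Rightarrow> (int \<Rightarrow> nat) \<Rightarrow> bool" where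
  "rauzy_admissible a d \<longleftrightarrow>
     (\<forall>i<2. d i = 0) \<and>
     (\<forall>i\<ge>2. d i \<in> {0..a - 1}) \<and>
     (\<forall>i\<ge>2. ([d i, d (i - 1), d (i - 2), d (i - 3)], [a - 1, a - 1, 0, 1]) \<in> lexord less_than)"

definition rauzy_fractal :: "nat \<Rightarrow> complex \<Rightarrow> complex set" where
  "rauzy_fractal a \<alpha> =
     {\<Sum>n. of_nat (d (int (n + 2))) * \<alpha> ^ (n + 2) | d. rauzy_admissible a d}"

lemma rauzy_roots_exist:
  assumes "3 \<le> a"
  shows "\<exists>\<beta> \<alpha>. rauzy_roots a \<beta> \<alpha>"
proof -
  define A where "A = real a"
  have A: "A \<ge> 3" using assms by (simp add: A_def)
  define f where "f = (\<lambda>x::real. x^3 - A * x^2 + x - 1)"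
  have "\<exists>x\<ge>1. x \<le> A \<and> f x = 0"
    by (rule IVT') (use A in \<open>auto simp: f_def power3_eq_cube power2_eq_square intro!: continuous_intros\<close>)
  then obtain b where b: "b \<ge> 1" "f b = 0" by blast
  have "f 1 \<noteq> 0" using A by (simp add: f_def)
  with b have b1: "b > 1" by (cases "b = 1") auto
  define s where "s = (A - b) / 2"
  have s: "b^2 * (2 * s) = b - 1"
  proof -
    have "2 * s = A - b" by (simp add: s_def)
    moreover have "b^2 * (A - b) = b - 1"
      using b(2) by (simp add: f_def algebra_simps power3_eq_cube power2_eq_square)
    ultimately show ?thesis by simp
  qed
  have s2: "2 * s = (b - 1) / b^2" using s b1 by (simp add: field_simps)
  have sb: "s^2 < 1 / b"
  proof -
    have "0 \<le> 2 * s" using s2 b1 by simp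
    have "2 * s \<le> 1 / b"
      unfolding s2 using b1 by (simp add: divide_simps power2_eq_square)
    hence "s \<le> 1 / b" using b1 \<open>0 \<le> 2 * s\<close> by linarith
    moreover have "s < 1"
    proof -
      have "1 / b < 1" using b1 by simp
      thus ?thesis using \<open>s \<le> 1 / b\<close> by linarith
    qed
    moreover have "0 < s"
    proof -
      have "0 < 2 * s" unfolding s2 using b1 by simp
      thus ?thesis by simp
    qed
    ultimately have "s * s < s * 1" "s \<le> 1 / b" by auto
    thus ?thesis by (simp add: power2_eq_square)
  qed
  define t where "t = sqrt (1 / b - s^2)"
  have t: "t > 0" "t^2 = 1 / b - s^2" using sb by (auto simp: t_def)
  define z where "z = Complex s t"
  have "norm z ^ 2 = 1 / b" by (simp add: z_def cmod_power2 t)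
  also have "\<dots> < 1" using b1 by simp
  finally have nz: "norm z < 1" by (simp add: power_less_one_iff abs_square_less_1)
  have zz: "z * cnj z = of_real (1 / b)"
    using t(2) by (simp add: z_def complex_eq_iff power2_eq_square)
  have zs: "z + cnj z = of_real (2 * s)" by (simp add: z_def complex_eq_iff)
  have expand: "[:- of_real b, 1:] * [:- z, 1:] * [:- cnj z, 1:] =
      [:- (of_real b * (z * cnj z)), of_real b * (z + cnj z) + z * cnj z,
        - (of_real b + (z + cnj z)), 1:]"
    by (simp add: algebra_simps)
  have c1: "of_real b * (z * cnj z) = 1" using b1 by (simp add: zz)
  have c2: "of_real b * (z + cnj z) + z * cnj z = 1"
  proof -
    have "b * (2 * s) + 1 / b = 1"
      unfolding s2 using b1 by (simp add: divide_simps power2_eq_square algebra_simps)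
    thus ?thesis unfolding zz zs by (metis of_real_1 of_real_add of_real_mult)
  qed
  have c3: "of_real b + (z + cnj z) = of_nat a"
  proof -
    have "b + 2 * s = real a" by (simp add: s_def A_def field_simps)
    thus ?thesis unfolding zs by (metis of_real_add of_real_of_nat_eq)
  qed
  have "z \<notin> \<real>" using t by (auto simp: z_def complex_is_Real_iff)
  hence "rauzy_roots a b z"
    unfolding rauzy_roots_def rauzy_poly_def expand c1 c2 c3 using b1 nz by simp
  thus ?thesis by blast
qed

end

theory Submission
  imports Defs
begin

text \<open>
  Up to the factor \<open>\<alpha>^2\<close>, the fractal is a tile \<open>T\<close> satisfying digit equations driven by a four-state
  automaton. With \<open>c = 1 / \<alpha> - 1\<close> and \<open>h = a - \<alpha>\<close>, the translates of \<open>T\<close> by the lattice spanned by \<open>c\<close> and \<open>h\<close>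
  cover the plane, because the greedy expansions of natural numbers in the associated linear
  recurrence are exactly the admissible strings. Comparing digits shows that \<open>T\<close> meets only its eight
  nearest translates: \<open>T \<inter> (T - c)\<close> is a set \<open>P\<close> invariant under a chain of contractions, the overlap
  with \<open>T - h\<close> is \<open>\<alpha> P\<close>, and the diagonal neighbours touch \<open>T\<close> in single points. The set \<open>P\<close> is
  parametrised by the fixed point of a refinement operator on curves, which is injective because two
  pieces of the chain can only meet in a common end point. Hence \<open>P\<close>, \<open>P + c\<close>, \<open>\<alpha> P\<close> and \<open>\<alpha> P + h\<close> form a Jordan
  curve that contains all overlaps of \<open>T\<close> with its translates, and this curve must be the frontier of \<open>T\<close>.
\<close>

section \<open>Arithmetic of the root\<close>

text \<open>If two tile points differ by p v + q h + r, removing a digit k from the first and l from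
  the second turns (p, q, r) into (p + q a + r + l - k, -p, -q). A common point of two translates is
  thus a walk on integer triples, and size bounds on differences force most digits. The bounds 2
  \<beta> - 1 and a + 1 - 1/\<beta> are exactly the sizes at which the vectors to be excluded begin,
  so they must be strict.

  The obstacle is that P is not a union of full copies of itself: after a nonzero digit the
  automaton restricts the continuation, and some copies shrink to the subarc over
  [0, \<open>len\<close> - 2]. That subarc is itself a union of whole pieces, so both sets are
  treated together, and curves to be refined need a prescribed value at \<open>len\<close> - 2
  besides their two ends.

  The constant \<open>len\<close> = 2a - 1 counts the pieces: a even ones, where the first digits of
  x and x + c agree, and a - 1 odd ones, where they differ by one. Each piece lives on a unit
  interval, so parameters expand by at least 3; this beats the factor 2 lost in the injectivity
  argument where adjacent pieces meet.\<close>

locale rauzy =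
  fixes a :: nat and \<beta> :: real and \<alpha> :: complex
  assumes a_ge: "a \<ge> 3" and roots: "rauzy_roots a \<beta> \<alpha>"
begin

definition v :: complex where "v = inverse \<alpha>"
definition c :: complex where "c = v - 1"
definition h :: complex where "h = of_nat a - \<alpha>"
text \<open>The fixed point of z -> \<alpha> z + h, hence the corner common to P and \<alpha> P + h;
  its digits repeat a - 1, a - 1, 0, 0. The other end of P is \<open>lft\<close>.\<close>

definition rgt :: complex where "rgt = h / (1 - \<alpha>)"
definition lft :: complex where "lft = \<alpha> * rgt"
definition tr :: real where "tr = real a - \<beta>"

lemma norm_alpha: "norm \<alpha> < 1" and alpha_nonreal: "\<alpha> \<notin> \<real>" and beta_gt1: "1 < \<beta>"
  using roots by (auto simp: rauzy_roots_def)

lemma alpha_nonzero [simp]: "\<alpha> \<noteq> 0" "\<alpha> \<noteq> 1"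
  using alpha_nonreal by auto

lemma Im_alpha [simp]: "Im \<alpha> \<noteq> 0"
  using alpha_nonreal by (simp add: complex_is_Real_iff)

lemma vieta:
  "of_real \<beta> * (\<alpha> * cnj \<alpha>) = 1"
  "of_real \<beta> * (\<alpha> + cnj \<alpha>) + \<alpha> * cnj \<alpha> = 1"
  "of_real \<beta> + (\<alpha> + cnj \<alpha>) = of_nat a"
proof -
  have "[:-1, 1, - of_nat a, 1:] =
      [:- (of_real \<beta> * (\<alpha> * cnj \<alpha>)), of_real \<beta> * (\<alpha> + cnj \<alpha>) + \<alpha> * cnj \<alpha>,
        - (of_real \<beta> + (\<alpha> + cnj \<alpha>)), 1:]"
    using roots unfolding rauzy_roots_def rauzy_poly_def by (simp add: algebra_simps)
  then show "of_real \<beta> * (\<alpha> * cnj \<alpha>) = 1"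
    "of_real \<beta> * (\<alpha> + cnj \<alpha>) + \<alpha> * cnj \<alpha> = 1"
    "of_real \<beta> + (\<alpha> + cnj \<alpha>) = of_nat a"
    by (simp_all only: pCons_eq_iff neg_equal_iff_equal)
qed

lemma alpha_cubic: "\<alpha>^3 = of_nat a * \<alpha>^2 - \<alpha> + 1"
proof -
  have "\<alpha>^3 - of_nat a * \<alpha>^2 + \<alpha> - 1 = 0"
    unfolding vieta(3)[symmetric] using vieta(1,2) by algebra
  then show ?thesis by (simp add: algebra_simps)
qed

lemma two_Re_alpha: "2 * Re \<alpha> = tr"
  using arg_cong[OF vieta(3), of Re] by (simp add: tr_def)

lemma norm_alpha_sq: "(Re \<alpha>)^2 + (Im \<alpha>)^2 = 1 / \<beta>"
proof -
  have "\<alpha> * cnj \<alpha> = of_real ((Re \<alpha>)^2 + (Im \<alpha>)^2)"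
    by (simp add: complex_mult_cnj)
  with vieta(1) have "of_real (\<beta> * ((Re \<alpha>)^2 + (Im \<alpha>)^2)) = (1::complex)"
    by (simp only: of_real_mult)
  then have "\<beta> * ((Re \<alpha>)^2 + (Im \<alpha>)^2) = 1"
    using of_real_eq_1_iff by blast
  then show ?thesis using beta_gt1 by (simp add: field_simps)
qed

lemma tr_eq: "tr = 1 / \<beta> - 1 / \<beta>^2"
proof -
  have "\<beta> * tr + 1 / \<beta> = 1"
    using arg_cong[OF vieta(2), of Re] norm_alpha_sq two_Re_alpha
    by (simp add: power2_eq_square)
  then show ?thesis using beta_gt1 by (simp add: field_simps power2_eq_square)
qed

text \<open>With w = 1/\<beta> the trace is w - w^2, at most 1/4, so \<beta> = a - \<open>tr\<close>
  is at least 3 - 1/4. Later estimates use this as 1/\<beta> \<le> 4/11.\<close>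

lemma beta_ge: "\<beta> \<ge> 11 / 4"
proof -
  define w where "w = 1 / \<beta>"
  have "tr = w - w^2"
    unfolding tr_eq w_def by (simp add: power_one_over)
  also have "\<dots> = 1 / 4 - (1 / 2 - w)^2"
    by (simp add: power2_eq_square algebra_simps)
  finally have "tr = 1 / 4 - (1 / 2 - w)^2" .
  then have "tr \<le> 1 / 4" by simp
  then show ?thesis using a_ge by (simp add: tr_def)
qed

lemma alpha_v [simp]: "\<alpha> * v = 1" "v * \<alpha> = 1"
  by (simp_all add: v_def)

lemma v_eq: "v = \<alpha>^2 - of_nat a * \<alpha> + 1"
proof -
  have "\<alpha> * v = \<alpha> * (\<alpha>^2 - of_nat a * \<alpha> + 1)"
    using alpha_cubic by (simp, algebra)
  then show ?thesis by (simp only: mult_cancel_left alpha_nonzero) simp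
qed

lemma alpha_c: "\<alpha> * c = 1 - \<alpha>"
  by (simp add: c_def algebra_simps)

lemma alpha_h: "\<alpha> * h = - c"
  by (simp add: c_def h_def v_eq power2_eq_square algebra_simps)

lemma v_mult_c: "v * c = - h"
proof -
  have "c = - (\<alpha> * h)" by (simp add: alpha_h)
  then have "v * c = - (v * \<alpha>) * h" by (simp only: mult.assoc mult_minus_right mult_minus_left)
  then show ?thesis by simp
qed

text \<open>With \<open>v_mult_h\<close> this gives multiplication by \<open>v\<close> in the basis
  \<open>v\<close>, \<open>h\<close>, 1, the linear part of \<open>lat_step\<close>.\<close>

lemma v_mult_v: "v * v = v - h"
  using v_mult_c by (simp add: c_def algebra_simps)

lemma v_mult_h: "v * h = of_nat a * v - 1"
  by (simp add: h_def algebra_simps)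

lemma rgt_eq: "rgt = lft + h"
  unfolding lft_def rgt_def by (simp add: field_simps)

text \<open>The fixed point equation of \<open>rgt\<close> rewritten; it makes \<alpha> P and P + c
  share the corner \<open>lft + c\<close>.\<close>

lemma alpha_lft: "\<alpha> * lft = lft + c"
proof -
  have "lft = \<alpha> * (lft + h)" using lft_def rgt_eq by metis
  then have "lft = \<alpha> * lft - c" by (simp only: distrib_left alpha_h) simp
  then show ?thesis by (simp add: algebra_simps)
qed

section \<open>Real coordinates in the basis \<open>1, \<alpha>\<close>\<close>

text \<open>In these coordinates multiplication by \<alpha> and the vectors \<open>lat p q r\<close>
  involve only \<open>a\<close> and \<beta>, so the decisive size estimates become inequalities in
  \<beta>.\<close>

definition Yc :: "complex \<Rightarrow> real" where "Yc z = Im z / Im \<alpha>"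
definition Xc :: "complex \<Rightarrow> real" where "Xc z = Re z - Yc z * Re \<alpha>"

lemma coords: "z = of_real (Xc z) + of_real (Yc z) * \<alpha>"
  by (simp add: complex_eq_iff Xc_def Yc_def)

lemma coords_unique:
  assumes "z = of_real x + of_real y * \<alpha>"
  shows "Xc z = x" "Yc z = y"
  by (simp_all add: assms Xc_def Yc_def)

lemma coord_simps [simp]:
  "Xc (z + w) = Xc z + Xc w" "Yc (z + w) = Yc z + Yc w"
  "Xc (z - w) = Xc z - Xc w" "Yc (z - w) = Yc z - Yc w"
  "Xc (- z) = - Xc z" "Yc (- z) = - Yc z"
  "Xc (of_real r * z) = r * Xc z" "Yc (of_real r * z) = r * Yc z"
  "Xc (of_int k * z) = of_int k * Xc z" "Yc (of_int k * z) = of_int k * Yc z"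
  "Xc (of_int k) = of_int k" "Yc (of_int k) = 0"
  "Xc (of_nat n) = of_nat n" "Yc (of_nat n) = 0"
  "Xc (of_nat n * z) = of_nat n * Xc z" "Yc (of_nat n * z) = of_nat n * Yc z"
  "Xc 1 = 1" "Yc 1 = 0" "Xc 0 = 0" "Yc 0 = 0" "Xc \<alpha> = 0" "Yc \<alpha> = 1"
  by (simp_all add: Xc_def Yc_def field_simps)

lemma alpha_square: "\<alpha>^2 = of_real tr * \<alpha> - of_real (1 / \<beta>)"
proof -
  have "\<alpha> * \<alpha> = of_real (2 * Re \<alpha>) * \<alpha> - of_real ((Re \<alpha>)^2 + (Im \<alpha>)^2)"
    by (simp add: complex_eq_iff power2_eq_square algebra_simps)
  from this[unfolded two_Re_alpha norm_alpha_sq] show ?thesis by (simp add: power2_eq_square)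
qed

lemma coord_alpha_mult:
  "Xc (\<alpha> * z) = - Yc z / \<beta>" "Yc (\<alpha> * z) = Xc z + tr * Yc z"
proof -
  have "\<alpha> * z = \<alpha> * (of_real (Xc z) + of_real (Yc z) * \<alpha>)"
    using coords by simp
  also have "\<dots> = of_real (Xc z) * \<alpha> + of_real (Yc z) * \<alpha>^2"
    by (simp add: algebra_simps power2_eq_square)
  also have "\<dots> = of_real (- Yc z / \<beta>) + of_real (Xc z + tr * Yc z) * \<alpha>"
    unfolding alpha_square by (simp add: algebra_simps)
  finally have *: "\<alpha> * z = of_real (- Yc z / \<beta>) + of_real (Xc z + tr * Yc z) * \<alpha>" .
  show "Xc (\<alpha> * z) = - Yc z / \<beta>" "Yc (\<alpha> * z) = Xc z + tr * Yc z"
    using coords_unique[OF *] by auto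
qed

lemma coord_v: "Xc v = 1 - 1 / \<beta>" "Yc v = - \<beta>"
proof -
  have "Yc v = - \<beta>"
    using coord_alpha_mult(1)[of v] beta_gt1 by (simp add: field_simps)
  moreover from this have "Xc v = tr * \<beta>"
    using coord_alpha_mult(2)[of v] by simp
  ultimately show "Xc v = 1 - 1 / \<beta>" "Yc v = - \<beta>"
    using beta_gt1 by (auto simp: tr_eq power2_eq_square diff_divide_distrib left_diff_distrib)
qed

lemma coord_h: "Xc h = a" "Yc h = -1"
  by (simp_all add: h_def)

end

section \<open>The digit automaton\<close>

datatype state = Zeros | Zero | Digit | Maxed

text \<open>The state records what matters of the digits read so far: \<open>Zeros\<close> after two zeros (and at the start),
  \<open>Zero\<close> after a single zero, \<open>Maxed\<close> after a maximal digit that cannot be followed by another one,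
  \<open>Digit\<close> otherwise.\<close>

definition nxt :: "nat \<Rightarrow> state \<Rightarrow> nat \<Rightarrow> state" where
  "nxt a s d = (if d = 0 then (if s = Zeros \<or> s = Zero then Zeros else Zero)
     else if d = a - 1 \<and> s \<noteq> Zeros then Maxed else Digit)"

definition allowed :: "nat \<Rightarrow> state \<Rightarrow> nat \<Rightarrow> bool" where
  "allowed a s d \<longleftrightarrow> d < a \<and> (s = Maxed \<longrightarrow> d \<noteq> a - 1)"

definition run :: "nat \<Rightarrow> state \<Rightarrow> (nat \<Rightarrow> nat) \<Rightarrow> bool" where
  "run a s d \<longleftrightarrow> (\<exists>\<sigma>. \<sigma> 0 = s \<and> (\<forall>n. allowed a (\<sigma> n) (d n) \<and> \<sigma> (Suc n) = nxt a (\<sigma> n) (d n)))"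

lemma run_Suc:
  assumes "run a s d"
  shows "allowed a s (d 0)" "run a (nxt a s (d 0)) (\<lambda>n. d (Suc n))"
proof -
  obtain \<sigma> where \<sigma>: "\<sigma> 0 = s" "\<And>n. allowed a (\<sigma> n) (d n)" "\<And>n. \<sigma> (Suc n) = nxt a (\<sigma> n) (d n)"
    using assms unfolding run_def by blast
  show "allowed a s (d 0)" using \<sigma>(1,2) by metis
  show "run a (nxt a s (d 0)) (\<lambda>n. d (Suc n))"
    unfolding run_def
  proof (intro exI[of _ "\<lambda>n. \<sigma> (Suc n)"] conjI allI)
    show "\<sigma> (Suc 0) = nxt a s (d 0)" using \<sigma>(1,3) by metis
  qed (rule \<sigma>)+
qed

lemma run_Cons:
  assumes "allowed a s k" "run a (nxt a s k) d"
  shows "run a s (case_nat k d)"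
proof -
  obtain \<sigma> where \<sigma>: "\<sigma> 0 = nxt a s k" "\<And>n. allowed a (\<sigma> n) (d n)" "\<And>n. \<sigma> (Suc n) = nxt a (\<sigma> n) (d n)"
    using assms(2) unfolding run_def by blast
  show ?thesis
    unfolding run_def by (rule exI[of _ "case_nat s \<sigma>"]) (use \<sigma> assms(1) in \<open>auto split: nat.split\<close>)
qed

lemma run_less: "run a s d \<Longrightarrow> d n < a"
  unfolding run_def allowed_def by blast

context rauzy
begin

definition ev :: "(nat \<Rightarrow> nat) \<Rightarrow> complex" where
  "ev d = (\<Sum>n. of_nat (d n) * \<alpha>^n)"

definition K :: "state \<Rightarrow> complex set" where
  "K s = ev ` {d. run a s d}"

lemma digit_series_summable:
  assumes "\<And>n. d n < a"
  shows "summable (\<lambda>n. norm (of_nat (d n) * \<alpha>^n))"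
proof (rule summable_comparison_test')
  show "summable (\<lambda>n. real a * norm \<alpha> ^ n)"
    using norm_alpha by (intro summable_mult summable_geometric) simp
  show "norm (norm (of_nat (d n) * \<alpha>^n)) \<le> real a * norm \<alpha> ^ n" for n
    using assms[of n] by (auto simp: norm_mult norm_power intro!: mult_right_mono)
qed

lemma ev_Suc:
  assumes "\<And>n. d n < a"
  shows "ev d = of_nat (d 0) + \<alpha> * ev (\<lambda>n. d (Suc n))"
proof -
  have 1: "summable (\<lambda>n. of_nat (d n) * \<alpha>^n)"
    using digit_series_summable[OF assms] by (rule summable_norm_cancel)
  have 2: "summable (\<lambda>n. of_nat (d (Suc n)) * \<alpha>^n)"
    using digit_series_summable[of "\<lambda>n. d (Suc n)"] assms by (blast intro: summable_norm_cancel)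
  have "ev d = of_nat (d 0) + (\<Sum>n. of_nat (d (Suc n)) * \<alpha>^Suc n)"
    using suminf_split_head[OF 1] by (simp add: ev_def)
  also have "(\<Sum>n. of_nat (d (Suc n)) * \<alpha>^Suc n) = (\<Sum>n. \<alpha> * (of_nat (d (Suc n)) * \<alpha>^n))"
    by (simp add: algebra_simps)
  also have "\<dots> = \<alpha> * ev (\<lambda>n. d (Suc n))"
    unfolding ev_def by (rule suminf_mult[OF 2])
  finally show ?thesis .
qed

lemma K_Cons:
  assumes "allowed a s k" "y \<in> K (nxt a s k)"
  shows "of_nat k + \<alpha> * y \<in> K s"
proof -
  obtain d where d: "run a (nxt a s k) d" "y = ev d" using assms(2) by (auto simp: K_def)
  have r: "run a s (case_nat k d)" using assms(1) d(1) by (rule run_Cons)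
  have "ev (case_nat k d) = of_nat k + \<alpha> * y"
    using ev_Suc[of "case_nat k d"] run_less[OF r] by (simp add: d(2))
  then show ?thesis using r unfolding K_def by (metis (mono_tags) imageI mem_Collect_eq)
qed

lemma K_cases:
  assumes "x \<in> K s"
  obtains k y where "allowed a s k" "y \<in> K (nxt a s k)" "x = of_nat k + \<alpha> * y"
proof -
  obtain d where d: "run a s d" "x = ev d" using assms by (auto simp: K_def)
  have "x = of_nat (d 0) + \<alpha> * ev (\<lambda>n. d (Suc n))"
    unfolding d(2) by (rule ev_Suc) (rule run_less[OF d(1)])
  moreover have "ev (\<lambda>n. d (Suc n)) \<in> K (nxt a s (d 0))"
    using run_Suc(2)[OF d(1)] by (auto simp: K_def)
  ultimately show ?thesis using that run_Suc(1)[OF d(1)] by blast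
qed

lemma K_bounded: "\<exists>B. \<forall>s. \<forall>x\<in>K s. norm x \<le> B"
proof (intro exI allI ballI)
  fix s x assume "x \<in> K s"
  then obtain d where d: "run a s d" "x = ev d" by (auto simp: K_def)
  note sm = digit_series_summable[of d, OF run_less[OF d(1)]]
  have "norm x \<le> (\<Sum>n. norm (of_nat (d n) * \<alpha>^n))"
    unfolding d(2) ev_def by (rule summable_norm[OF sm])
  also have "\<dots> \<le> (\<Sum>n. real a * norm \<alpha> ^ n)"
    using norm_alpha run_less[OF d(1)]
    by (intro suminf_le[OF _ sm] summable_mult summable_geometric)
      (auto simp: norm_mult norm_power intro!: mult_right_mono less_imp_le)
  finally show "norm x \<le> (\<Sum>n. real a * norm \<alpha> ^ n)" .
qed

text \<open>The sets \<open>K s\<close> form the greatest bounded solution of the digit equations.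
  Choosing a digit and a tail again and again yields a run; after n steps the remainder is
  \<alpha>^n times a bounded quantity, so the digit series converges to x.\<close>

lemma K_coinduct:
  assumes bnd: "\<And>s x. x \<in> X s \<Longrightarrow> norm x \<le> B"
    and step: "\<And>s x. x \<in> X s \<Longrightarrow> \<exists>k y. allowed a s k \<and> y \<in> X (nxt a s k) \<and> x = of_nat k + \<alpha> * y"
  shows "X s \<subseteq> K s"
proof
  fix x assume x: "x \<in> X s"
  define good where "good s x p \<longleftrightarrow> allowed a s (fst p) \<and> snd p \<in> X (nxt a s (fst p)) \<and>
    x = of_nat (fst p) + \<alpha> * snd p" for s x and p :: "nat \<times> complex"
  define dig where "dig s x = fst (SOME p. good s x p)" for s x
  define tl where "tl s x = snd (SOME p. good s x p)" for s x
  have dt: "allowed a s (dig s x) \<and> tl s x \<in> X (nxt a s (dig s x)) \<and>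
      x = of_nat (dig s x) + \<alpha> * tl s x" if "x \<in> X s" for s x
  proof -
    have "\<exists>p. good s x p" using step[OF that] by (auto simp: good_def)
    then have "good s x (SOME p. good s x p)" by (rule someI_ex)
    then show ?thesis unfolding good_def dig_def tl_def .
  qed
  define p where "p = rec_nat (s, x) (\<lambda>_ (s, x). (nxt a s (dig s x), tl s x))"
  define d where "d = (\<lambda>n. dig (fst (p n)) (snd (p n)))"
  have p0: "p 0 = (s, x)" by (simp add: p_def)
  have pS: "p (Suc n) = (nxt a (fst (p n)) (d n), tl (fst (p n)) (snd (p n)))" for n
    by (simp add: p_def d_def case_prod_beta)
  have inX: "snd (p n) \<in> X (fst (p n))" for n
    by (induction n) (use x dt in \<open>auto simp: p0 pS d_def\<close>)
  have r: "run a s d"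
    unfolding run_def by (rule exI[of _ "\<lambda>n. fst (p n)"]) (use dt[OF inX] in \<open>auto simp: p0 pS d_def\<close>)
  have expand: "x = (\<Sum>i<n. of_nat (d i) * \<alpha>^i) + \<alpha>^n * snd (p n)" for n
  proof (induction n)
    case (Suc n)
    have "snd (p n) = of_nat (d n) + \<alpha> * snd (p (Suc n))"
      using dt[OF inX, of n] by (simp add: pS d_def)
    with Suc show ?case by (simp add: algebra_simps)
  qed (simp add: p0)
  have "(\<lambda>n. \<alpha>^n * snd (p n)) \<longlonglongrightarrow> 0"
  proof (rule Lim_null_comparison)
    show "\<forall>\<^sub>F n in sequentially. norm (\<alpha>^n * snd (p n)) \<le> norm \<alpha> ^ n * B"
      using bnd[OF inX] by (intro always_eventually allI) (auto simp: norm_mult norm_power intro!: mult_left_mono)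
    show "(\<lambda>n. norm \<alpha> ^ n * B) \<longlonglongrightarrow> 0"
      using norm_alpha by (intro tendsto_mult_left_zero LIMSEQ_power_zero) simp
  qed
  then have "(\<lambda>n. x - \<alpha>^n * snd (p n)) \<longlonglongrightarrow> x - 0" by (intro tendsto_intros)
  moreover have "(\<lambda>n. x - \<alpha>^n * snd (p n)) = (\<lambda>n. \<Sum>i<n. of_nat (d i) * \<alpha>^i)"
    using expand by (simp add: fun_eq_iff algebra_simps)
  ultimately have "(\<lambda>i. of_nat (d i) * \<alpha>^i) sums x" by (simp add: sums_def)
  then show "x \<in> K s" using r unfolding K_def ev_def by (auto simp: sums_iff)
qed

text \<open>The transitions are monotone for the order \<open>Maxed\<close>, \<open>Digit\<close>, \<open>Zero\<close>, \<open>Zeros\<close> of the states.\<close>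

lemma K_mono: "K Maxed \<subseteq> K Digit" "K Digit \<subseteq> K Zero" "K Zero \<subseteq> K Zeros"
proof -
  define X where "X s = (case s of Zeros \<Rightarrow> K Zeros \<union> K Zero \<union> K Digit \<union> K Maxed | Zero \<Rightarrow> K Zero \<union> K Digit \<union> K Maxed
    | Digit \<Rightarrow> K Digit \<union> K Maxed | Maxed \<Rightarrow> K Maxed)" for s
  obtain B where B: "\<And>s x. x \<in> K s \<Longrightarrow> norm x \<le> B" using K_bounded by blast
  have "X s \<subseteq> K s" for s
  proof (rule K_coinduct)
    show "norm x \<le> B" if "x \<in> X s" for s x
      using that B by (auto simp: X_def split: state.splits)
    fix s x assume "x \<in> X s"
    then obtain s' where s': "x \<in> K s'" and le: "s' = s \<or> s = Zeros \<or> (s = Zero \<and> s' \<noteq> Zeros) \<or> (s = Digit \<and> s' = Maxed)"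
      by (auto simp: X_def split: state.splits)
    from s' obtain k y where ky: "allowed a s' k" "y \<in> K (nxt a s' k)" "x = of_nat k + \<alpha> * y"
      by (rule K_cases)
    have "allowed a s k" using ky(1) le by (auto simp: allowed_def)
    moreover have "y \<in> X (nxt a s k)"
      using ky(2) le by (cases s; cases s') (auto simp: X_def nxt_def split: if_splits)
    ultimately show "\<exists>k y. allowed a s k \<and> y \<in> X (nxt a s k) \<and> x = of_nat k + \<alpha> * y"
      using ky(3) by blast
  qed
  from this[of Zeros] this[of Zero] this[of Digit] show "K Maxed \<subseteq> K Digit" "K Digit \<subseteq> K Zero" "K Zero \<subseteq> K Zeros"
    by (auto simp: X_def)
qed

lemma K_subset: "K s \<subseteq> K Zeros"
  using K_mono by (cases s) auto

text \<open>The closures satisfy the digit equations too, since a finite union of affine images of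
  compact sets is closed; coinduction then puts them inside \<open>K\<close>.\<close>

lemma K_closed: "closed (K s)"
proof -
  obtain B where B: "\<And>s x. x \<in> K s \<Longrightarrow> norm x \<le> B" using K_bounded by blast
  have "closure (K s) \<subseteq> K s"
  proof (rule K_coinduct)
    show "norm x \<le> B" if "x \<in> closure (K s)" for s x
    proof -
      have "K s \<subseteq> cball 0 B" using B by auto
      then have "closure (K s) \<subseteq> cball 0 B" by (rule closure_minimal) simp
      then show ?thesis using that by auto
    qed
    fix s x assume x: "x \<in> closure (K s)"
    define F where "F = {k. allowed a s k}"
    have "finite F" by (rule finite_subset[of _ "{..<a}"]) (auto simp: F_def allowed_def)
    define U where "U = (\<Union>k\<in>F. (\<lambda>y. of_nat k + \<alpha> * y) ` closure (K (nxt a s k)))"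
    have "K s \<subseteq> U"
    proof
      fix z assume "z \<in> K s"
      then obtain k y where "allowed a s k" "y \<in> K (nxt a s k)" "z = of_nat k + \<alpha> * y"
        by (rule K_cases)
      then show "z \<in> U" using closure_subset unfolding U_def F_def by blast
    qed
    moreover have "compact (closure (K s'))" for s'
      using B by (auto simp: compact_closure bounded_iff)
    then have "closed U"
      using \<open>finite F\<close> unfolding U_def
      by (intro closed_UN ballI compact_imp_closed compact_continuous_image continuous_intros) auto
    ultimately have "closure (K s) \<subseteq> U" by (rule closure_minimal)
    then show "\<exists>k y. allowed a s k \<and> y \<in> closure (K (nxt a s k)) \<and> x = of_nat k + \<alpha> * y"
      using x unfolding U_def F_def by blast
  qed
  then show ?thesis using closure_subset_eq by blast
qed

lemma K_compact: "compact (K s)"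
  using K_closed K_bounded by (auto simp: compact_eq_bounded_closed bounded_iff)

end

section \<open>Differences of points of the tile\<close>

context rauzy
begin

definition Dif :: "complex set" where
  "Dif = {x - y | x y. x \<in> K Zeros \<and> y \<in> K Zeros}"

text \<open>States are forgotten here: all \<open>K s\<close> lie in \<open>K Zeros\<close>, and an
  upper bound for the larger set is enough.\<close>

lemma Dif_step:
  assumes "z \<in> Dif"
  obtains k :: int and z' where "\<bar>k\<bar> \<le> int a - 1" "z' \<in> Dif" "z = of_int k + \<alpha> * z'"
proof -
  obtain x y where xy: "x \<in> K Zeros" "y \<in> K Zeros" "z = x - y"
    using assms by (auto simp: Dif_def)
  obtain k x' where k: "allowed a Zeros k" "x' \<in> K (nxt a Zeros k)" "x = of_nat k + \<alpha> * x'"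
    using xy(1) by (rule K_cases)
  obtain l y' where l: "allowed a Zeros l" "y' \<in> K (nxt a Zeros l)" "y = of_nat l + \<alpha> * y'"
    using xy(2) by (rule K_cases)
  show thesis
  proof (rule that)
    show "\<bar>int k - int l\<bar> \<le> int a - 1" using k(1) l(1) by (auto simp: allowed_def)
    show "x' - y' \<in> Dif" using k(2) l(2) K_subset unfolding Dif_def by blast
    show "z = of_int (int k - int l) + \<alpha> * (x' - y')" by (simp add: xy(3) k(3) l(3) algebra_simps)
  qed
qed

lemma tr_bounds: "0 < tr" "tr < 1"
proof -
  have "\<beta> < \<beta>^2" "0 < 1 / \<beta>^2" "1 / \<beta> < 1" using beta_ge by (auto simp: power2_eq_square)
  moreover from this beta_ge have "1 / \<beta>^2 < 1 / \<beta>" by (intro divide_strict_left_mono) auto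
  ultimately show "0 < tr" "tr < 1" unfolding tr_eq by linarith+
qed

text \<open>Expanding three digits is needed for \<open>a = 3\<close>, where bounding digit by digit is too weak.\<close>

lemma Yc_bound:
  assumes "z \<in> Dif"
  shows "\<bar>Yc z\<bar> < 2 * \<beta> - 1"
proof -
  define b where "b = 1 / \<beta>"
  define A where "A = real a - 1"
  \<comment> \<open>The total weight, \<open>b - tr^2\<close> plus \<open>tr * b\<close>, with which
    the second and third tails enter \<open>Yc z\<close>. The leading digit has no
    \<alpha>-coordinate and drops out.\<close>
  define \<rho> where "\<rho> = b - tr^2 + tr * b"
  define S where "S = (SUP z\<in>Dif. \<bar>Yc z\<bar>)"
  have b: "0 < b" "b \<le> 4 / 11" using beta_ge by (auto simp: b_def field_simps)
  have b2: "\<beta> * b = 1" using beta_ge by (simp add: b_def)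
  have tr: "tr = b - b^2" by (simp add: tr_eq b_def power_one_over)
  have "tr \<le> b" by (simp add: tr)
  have "tr^2 \<le> b"
  proof -
    have "tr^2 \<le> b^2" using \<open>tr \<le> b\<close> tr_bounds by (intro power_mono) auto
    also have "\<dots> \<le> b" using b by (simp add: power2_eq_square mult_left_le)
    finally show ?thesis .
  qed
  obtain B where B: "\<And>s x. x \<in> K s \<Longrightarrow> norm x \<le> B" using K_bounded by blast
  have bdd: "bdd_above ((\<lambda>z. \<bar>Yc z\<bar>) ` Dif)"
  proof (intro bdd_aboveI2)
    fix z assume "z \<in> Dif"
    then obtain x y where "x \<in> K Zeros" "y \<in> K Zeros" "z = x - y" by (auto simp: Dif_def)
    then have "norm z \<le> 2 * B" using B[of x Zeros] B[of y Zeros] norm_triangle_ineq4[of x y] by simp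
    then have "\<bar>Im z\<bar> \<le> 2 * B" using abs_Im_le_cmod[of z] by linarith
    then show "\<bar>Yc z\<bar> \<le> 2 * B / \<bar>Im \<alpha>\<bar>" by (simp add: Yc_def divide_right_mono)
  qed
  have S: "\<bar>Yc z\<bar> \<le> S" if "z \<in> Dif" for z
    unfolding S_def using that bdd by (rule cSUP_upper)
  have step: "\<bar>Yc z\<bar> \<le> A * (1 + tr) + \<rho> * S" if z: "z \<in> Dif" for z
  proof -
    obtain k0 z1 where z1: "\<bar>k0\<bar> \<le> int a - 1" "z1 \<in> Dif" "z = of_int k0 + \<alpha> * z1" using z by (rule Dif_step)
    obtain k1 z2 where z2: "\<bar>k1\<bar> \<le> int a - 1" "z2 \<in> Dif" "z1 = of_int k1 + \<alpha> * z2"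
      using z1(2) by (rule Dif_step)
    obtain k2 z3 where z3: "\<bar>k2\<bar> \<le> int a - 1" "z3 \<in> Dif" "z2 = of_int k2 + \<alpha> * z3"
      using z2(2) by (rule Dif_step)
    have X2: "Xc z2 = k2 - b * Yc z3" unfolding z3(3) by (simp add: coord_alpha_mult b_def)
    have "Yc z = k1 - b * Yc z2 + tr * (Xc z2 + tr * Yc z2)"
      unfolding z1(3) z2(3) by (simp add: coord_alpha_mult b_def)
    then have "Yc z = k1 + tr * k2 - (b - tr^2) * Yc z2 - (tr * b) * Yc z3"
      unfolding X2 by (simp add: algebra_simps power2_eq_square)
    moreover have "\<bar>real_of_int k1\<bar> \<le> A" "\<bar>real_of_int k2\<bar> \<le> A"
      using z2(1) z3(1) by (auto simp: A_def)
    then have "\<bar>real_of_int k1\<bar> \<le> A" "\<bar>tr * k2\<bar> \<le> tr * A"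
      using tr_bounds by (auto simp: abs_mult)
    moreover have "\<bar>(b - tr^2) * Yc z2\<bar> \<le> (b - tr^2) * S"
      using S[OF z2(2)] \<open>tr^2 \<le> b\<close> by (auto simp: abs_mult intro: mult_left_mono)
    moreover have "\<bar>(tr * b) * Yc z3\<bar> \<le> (tr * b) * S"
      using S[OF z3(2)] tr_bounds b by (auto simp: abs_mult intro!: mult_left_mono)
    ultimately have "\<bar>Yc z\<bar> \<le> A + tr * A + (b - tr^2) * S + (tr * b) * S" by linarith
    then show ?thesis by (simp add: \<rho>_def algebra_simps)
  qed
  have "S \<le> A * (1 + tr) + \<rho> * S"
    unfolding S_def[symmetric] using assms step unfolding S_def by (intro cSUP_least) (auto simp: S_def)
  then have S1: "S * (1 - \<rho>) \<le> A * (1 + tr)" by (simp add: algebra_simps)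
  have A: "A = \<beta> - 1 + b - b^2" using tr by (simp add: A_def tr_def)
  \<comment> \<open>This polynomial is \<open>b\<close> times the gap between
    \<open>(2 * \<beta> - 1) * (1 - \<rho>)\<close> and \<open>A * (1 + tr)\<close>, with everything
    expressed through \<open>b\<close>.\<close>
  have "0 < 1 - 3 * b + 2 * b^2 - 3 * b^3 + 5 * b^4 - 2 * b^5"
  proof -
    have "0 \<le> (b - 4/11) * (b - 4/11)" "0 \<le> b^2" "0 \<le> b^4" by simp_all
    have "b^3 \<le> (4/11)^2 * b" "b^5 \<le> (4/11) * b^4"
      using mult_mono[of b "4/11" "b^2" "(4/11) * b"] b
        mult_right_mono[of "b * b" "(4/11)^2" b] mult_mono[of b "4/11" b "4/11"]
        mult_right_mono[of b "4/11" "b^4"]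
      by (auto simp: power2_eq_square eval_nat_numeral algebra_simps)
    moreover have "b^2 \<ge> (8/11) * b - (4/11)^2"
      using \<open>0 \<le> (b - 4/11) * (b - 4/11)\<close> by (simp add: power2_eq_square algebra_simps)
    ultimately show ?thesis using b \<open>0 \<le> b^4\<close> unfolding power2_eq_square[of "4/11"] by linarith
  qed
  then have "b * (A * (1 + tr)) < b * ((2 * \<beta> - 1) * (1 - \<rho>))"
  proof -
    have bA: "b * A = 1 - b + b^2 - b^3"
      using b2 unfolding A by (simp add: algebra_simps power2_eq_square power3_eq_cube)
    have bB: "b * (2 * \<beta> - 1) = 2 - b" using b2 by (simp add: algebra_simps)
    have "b * (A * (1 + tr)) = (1 - b + b^2 - b^3) * (1 + tr)"
      unfolding bA[symmetric] by simp
    moreover have "b * ((2 * \<beta> - 1) * (1 - \<rho>)) = (2 - b) * (1 - \<rho>)"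
      unfolding bB[symmetric] by simp
    moreover have "(2 - b) * (1 - \<rho>) - (1 - b + b^2 - b^3) * (1 + tr) =
        1 - 3 * b + 2 * b^2 - 3 * b^3 + 5 * b^4 - 2 * b^5"
      unfolding \<rho>_def tr by (simp add: algebra_simps eval_nat_numeral)
    ultimately show ?thesis
      using \<open>0 < 1 - 3 * b + 2 * b^2 - 3 * b^3 + 5 * b^4 - 2 * b^5\<close> by linarith
  qed
  then have "A * (1 + tr) < (2 * \<beta> - 1) * (1 - \<rho>)" using b by simp
  with S1 have "S * (1 - \<rho>) < (2 * \<beta> - 1) * (1 - \<rho>)" by linarith
  moreover have "0 \<le> 1 - \<rho>"
  proof -
    have "tr * b \<le> 1 * b" using tr_bounds b by (intro mult_right_mono) auto
    then have "\<rho> \<le> 2 * b" unfolding \<rho>_def using zero_le_power2[of tr] by linarith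
    then show ?thesis using b by simp
  qed
  ultimately have "S < 2 * \<beta> - 1" by (rule mult_right_less_imp_less)
  then show ?thesis using S[OF assms] by simp
qed

text \<open>One digit contributes at most a - 1, and the tail contributes its \<open>Yc\<close>
  divided by \<beta>, which is less than 2 - 1/\<beta>.\<close>

lemma Xc_bound:
  assumes "z \<in> Dif"
  shows "\<bar>Xc z\<bar> < real a + 1 - 1 / \<beta>"
proof -
  obtain k z' where z': "\<bar>k\<bar> \<le> int a - 1" "z' \<in> Dif" "z = of_int k + \<alpha> * z'"
    using assms by (rule Dif_step)
  have "\<bar>Yc z' / \<beta>\<bar> < (2 * \<beta> - 1) / \<beta>"
    using Yc_bound[OF z'(2)] beta_gt1 by (simp add: divide_strict_right_mono)
  moreover have "(2 * \<beta> - 1) / \<beta> = 2 - 1 / \<beta>" using beta_gt1 by (simp add: field_simps)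
  moreover have "Xc z = k - Yc z' / \<beta>" by (simp add: z'(3) coord_alpha_mult)
  moreover have "\<bar>real_of_int k\<bar> \<le> real a - 1" using z'(1) by linarith
  ultimately show ?thesis by linarith
qed

text \<open>Elements of Z[\<alpha>] in the basis \<open>v\<close>, \<open>h\<close>, 1.
  Multiplication by \<open>v\<close> shifts the coefficients in this basis, so a removed digit
  affects only the first of them.\<close>

definition lat :: "int \<Rightarrow> int \<Rightarrow> int \<Rightarrow> complex" where
  "lat p q r = of_int p * v + of_int q * h + of_int r"

lemma coord_lat: "Xc (lat p q r) = (1 - 1 / \<beta>) * p + real a * q + r" "Yc (lat p q r) = - (\<beta> * p + q)"
  by (simp_all add: lat_def coord_v coord_h algebra_simps)

lemma lat_Dif:
  assumes "x \<in> K s1" "y \<in> K s2" "x = y + lat p q r"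
  shows "\<bar>\<beta> * p + q\<bar> < 2 * \<beta> - 1" "\<bar>(1 - 1 / \<beta>) * p + real a * q + r\<bar> < real a + 1 - 1 / \<beta>"
proof -
  have "x - y \<in> Dif" using assms(1,2) K_subset unfolding Dif_def by blast
  moreover have "x - y = lat p q r" by (simp add: assms(3))
  ultimately have "lat p q r \<in> Dif" by simp
  from Yc_bound[OF this] Xc_bound[OF this] show "\<bar>\<beta> * p + q\<bar> < 2 * \<beta> - 1"
    "\<bar>(1 - 1 / \<beta>) * p + real a * q + r\<bar> < real a + 1 - 1 / \<beta>" by (simp_all add: coord_lat)
qed

text \<open>The smallest value of |\<beta> p + q| with |p| \<ge> 2 and |q| \<le> 1 is 2 \<beta> - 1,
  just what \<open>Yc_bound\<close> excludes.\<close>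

lemma lat_v_le:
  assumes "x \<in> K s1" "y \<in> K s2" "x = y + lat p q r" "\<bar>q\<bar> \<le> 1"
  shows "\<bar>p\<bar> \<le> 1"
proof (rule ccontr)
  assume "\<not> \<bar>p\<bar> \<le> 1"
  then have "2 \<le> \<bar>real_of_int p\<bar>" by linarith
  then have "\<beta> * 2 \<le> \<beta> * \<bar>real_of_int p\<bar>" using beta_gt1 by (intro mult_left_mono) auto
  then have "2 * \<beta> \<le> \<bar>\<beta> * p\<bar>" using beta_gt1 by (simp add: abs_mult)
  moreover have "\<bar>real_of_int q\<bar> \<le> 1" using assms(4) by linarith
  ultimately show False using lat_Dif(1)[OF assms(1-3)] by linarith
qed

text \<open>Here \<open>Xc\<close> is at least (1 - 1/\<beta>) + a, exactly the value that the
  strict \<open>Xc_bound\<close> excludes.\<close>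

lemma lat_hv_False:
  assumes "x \<in> K s1" "y \<in> K s2" "x = y + lat p 1 r" "1 \<le> p" "0 \<le> r"
  shows False
proof -
  have "0 \<le> 1 - 1 / \<beta>" using beta_gt1 by simp
  then have "(1 - 1 / \<beta>) * 1 \<le> (1 - 1 / \<beta>) * p" using assms(4) by (intro mult_left_mono) auto
  moreover have "0 \<le> real_of_int r" using assms(5) by simp
  ultimately show False using lat_Dif(2)[OF assms(1-3)] by simp
qed

text \<open>Removing one digit from both points subtracts the digits and multiplies the difference
  by \<open>v\<close>.\<close>

lemma lat_step:
  assumes "x \<in> K s1" "y \<in> K s2" "x = y + lat p q r"
  obtains k x' l y' where "allowed a s1 k" "x' \<in> K (nxt a s1 k)" "x = of_nat k + \<alpha> * x'"
    "allowed a s2 l" "y' \<in> K (nxt a s2 l)" "y = of_nat l + \<alpha> * y'"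
    "x' = y' + lat (p + q * int a + r + int l - int k) (- p) (- q)"
proof -
  obtain k x' where k: "allowed a s1 k" "x' \<in> K (nxt a s1 k)" "x = of_nat k + \<alpha> * x'"
    using assms(1) by (rule K_cases)
  obtain l y' where l: "allowed a s2 l" "y' \<in> K (nxt a s2 l)" "y = of_nat l + \<alpha> * y'"
    using assms(2) by (rule K_cases)
  have "\<alpha> * x' = \<alpha> * y' + lat p q r + of_nat l - of_nat k"
    using assms(3) by (simp add: k(3) l(3) algebra_simps)
  then have "v * (\<alpha> * x') = v * (\<alpha> * y' + lat p q r + of_nat l - of_nat k)" by simp
  then have "(v * \<alpha>) * x' = (v * \<alpha>) * y' + v * lat p q r + v * of_nat l - v * of_nat k"
    by (simp only: ring_distribs mult.assoc)
  then have "x' = y' + v * lat p q r + of_nat l * v - of_nat k * v" by (simp add: mult.commute)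
  also have "v * lat p q r = of_int p * (v * v) + of_int q * (v * h) + of_int r * v"
    by (simp add: lat_def algebra_simps)
  finally have "x' = y' + lat (p + q * int a + r + int l - int k) (- p) (- q)"
    unfolding v_mult_v v_mult_h by (simp add: lat_def algebra_simps)
  with k l show thesis by (rule that)
qed

text \<open>The new first coefficient is a + l - k, which \<open>lat_v_le\<close> bounds by 1; only
  k = a - 1 and l = 0 achieve this.\<close>

lemma lat_step_up:
  assumes "x \<in> K s1" "y \<in> K s2" "x = y + lat p q r" "p + q * int a + r = int a" "\<bar>p\<bar> \<le> 1"
  obtains x' y' where "x' \<in> K (nxt a s1 (a - 1))" "y' \<in> K (nxt a s2 0)"
    "x = of_nat (a - 1) + \<alpha> * x'" "y = \<alpha> * y'" "x' = y' + lat 1 (- p) (- q)"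
proof -
  obtain k x' l y' where kl: "allowed a s1 k" "x' \<in> K (nxt a s1 k)" "x = of_nat k + \<alpha> * x'"
    "allowed a s2 l" "y' \<in> K (nxt a s2 l)" "y = of_nat l + \<alpha> * y'"
    "x' = y' + lat (p + q * int a + r + int l - int k) (- p) (- q)"
    using assms(1-3) by (rule lat_step)
  have "\<bar>p + q * int a + r + int l - int k\<bar> \<le> 1"
    by (rule lat_v_le[OF kl(2,5,7)]) (use assms(5) in simp)
  then have "k = a - 1 \<and> l = 0" using kl(1,4) assms(4) by (auto simp: allowed_def)
  moreover have "int a - int (a - 1) = 1" using a_ge by simp
  ultimately show thesis using kl assms(4) by (intro that[of x' y']) simp_all
qed

lemma lat_uminus: "x = y + lat p q r \<longleftrightarrow> y = x + lat (- p) (- q) (- r)"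
  by (auto simp: lat_def algebra_simps)

lemma lat_step_down:
  assumes "x \<in> K s1" "y \<in> K s2" "x = y + lat p q r" "p + q * int a + r = - int a" "\<bar>p\<bar> \<le> 1"
  obtains x' y' where "x' \<in> K (nxt a s1 0)" "y' \<in> K (nxt a s2 (a - 1))"
    "x = \<alpha> * x'" "y = of_nat (a - 1) + \<alpha> * y'" "x' = y' + lat (-1) (- p) (- q)"
proof -
  have "- p + - q * int a + - r = int a" "\<bar>- p\<bar> \<le> 1" using assms(4,5) by auto
  with assms(2,1) assms(3)[unfolded lat_uminus[of x]] obtain x' y' where
    "x' \<in> K (nxt a s2 (a - 1))" "y' \<in> K (nxt a s1 0)" "y = of_nat (a - 1) + \<alpha> * x'" "x = \<alpha> * y'"
    "x' = y' + lat 1 (- (- p)) (- (- q))"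
    by (rule lat_step_up)
  then show thesis by (intro that[of y' x']) (simp_all add: lat_uminus[of y'])
qed

section \<open>Corner points and their forced periodic expansions\<close>

lemma rgt_expansion:
  "rgt = of_nat (a - 1) + \<alpha> * (of_nat (a - 1) + \<alpha> * (\<alpha> * (\<alpha> * rgt)))"
  "rgt + c = of_nat (a - 1) + \<alpha> * (\<alpha> * (\<alpha> * rgt))"
proof -
  have a1: "of_nat (a - 1) = of_nat a - (1::complex)" using a_ge by simp
  have 1: "\<alpha> * rgt = lft" by (simp add: lft_def)
  have "\<alpha> * (\<alpha> * (\<alpha> * rgt)) = \<alpha> * (lft + c)" by (simp only: 1 alpha_lft)
  also have "\<dots> = lft + c + 1 - \<alpha>" by (simp only: distrib_left alpha_lft alpha_c) simp
  finally have 3: "\<alpha> * (\<alpha> * (\<alpha> * rgt)) = lft + c + 1 - \<alpha>" .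
  show "rgt + c = of_nat (a - 1) + \<alpha> * (\<alpha> * (\<alpha> * rgt))"
    unfolding 3 a1 by (simp add: rgt_eq h_def)
  have "\<alpha> * (\<alpha> * (\<alpha> * (\<alpha> * rgt))) = \<alpha> * lft + \<alpha> * c + \<alpha> - \<alpha>^2"
    unfolding 3 by (simp add: algebra_simps power2_eq_square)
  also have "\<dots> = lft + v - \<alpha>^2" by (simp only: alpha_lft alpha_c) (simp add: c_def)
  finally have 4: "\<alpha> * (\<alpha> * (\<alpha> * (\<alpha> * rgt))) = lft + v - \<alpha>^2" .
  have "of_nat (a - 1) + \<alpha> * (of_nat (a - 1) + \<alpha> * (\<alpha> * (\<alpha> * rgt))) =
      of_nat a - 1 + \<alpha> * (of_nat a - 1) + \<alpha> * (\<alpha> * (\<alpha> * (\<alpha> * rgt)))"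
    unfolding a1 by (simp add: algebra_simps)
  also have "\<dots> = rgt" unfolding 4 by (simp add: rgt_eq h_def v_eq algebra_simps)
  finally show "rgt = of_nat (a - 1) + \<alpha> * (of_nat (a - 1) + \<alpha> * (\<alpha> * (\<alpha> * rgt)))" ..
qed

text \<open>The difference runs through (1,1,-1), (1,-1,-1), (-1,-1,1), (-1,1,1), and every step
  meets the hypotheses of \<open>lat_step_up\<close> or \<open>lat_step_down\<close>, so the digits
  a - 1, 0, 0 of x are forced.\<close>

lemma corner_cycle:
  assumes "x \<in> K Zeros" "y \<in> K Zeros" "x = y + lat 1 1 (-1)"
  obtains x' y' where "x' \<in> K Zeros" "y' \<in> K Zeros" "x' = y' + lat (-1) 1 1"
    "x = of_nat (a - 1) + \<alpha> * (\<alpha> * (\<alpha> * x'))"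
proof -
  have "1 + 1 * int a + -1 = int a" "\<bar>1::int\<bar> \<le> 1" by auto
  with assms obtain x1 y1 where 1: "x1 \<in> K (nxt a Zeros (a - 1))" "y1 \<in> K (nxt a Zeros 0)"
    "x = of_nat (a - 1) + \<alpha> * x1" "y = \<alpha> * y1" "x1 = y1 + lat 1 (- 1) (- 1)"
    by (rule lat_step_up)
  have "1 + -1 * int a + -1 = - int a" "\<bar>1::int\<bar> \<le> 1" by auto
  with 1(1,2,5) obtain x2 y2 where 2: "x2 \<in> K (nxt a (nxt a Zeros (a - 1)) 0)"
    "y2 \<in> K (nxt a (nxt a Zeros 0) (a - 1))"
    "x1 = \<alpha> * x2" "y1 = of_nat (a - 1) + \<alpha> * y2" "x2 = y2 + lat (-1) (- 1) (- (- 1))"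
    by (rule lat_step_down)
  have "-1 + -1 * int a + - (- 1) = - int a" "\<bar>-1::int\<bar> \<le> 1" by auto
  with 2(1,2,5) obtain x3 y3 where 3: "x3 \<in> K (nxt a (nxt a (nxt a Zeros (a - 1)) 0) 0)"
    "y3 \<in> K (nxt a (nxt a (nxt a Zeros 0) (a - 1)) (a - 1))"
    "x2 = \<alpha> * x3" "y2 = of_nat (a - 1) + \<alpha> * y3" "x3 = y3 + lat (-1) (- (-1)) (- (- 1))"
    by (rule lat_step_down)
  show thesis
    by (rule that[of x3 y3]) (use 1 2 3 K_subset in auto)
qed

text \<open>One upward step leads from (-1,1,1) to (1,1,-1), and \<open>corner_cycle\<close> leads
  back. All digits have forced period four, so x agrees with \<open>rgt\<close> up to arbitrarily
  high powers of \<alpha>^4.\<close>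

lemma corner_minus:
  assumes "x \<in> K s1" "y \<in> K s2" "x = y + lat (-1) 1 1"
  shows "x = rgt"
proof -
  define C where "C = {x. \<exists>y. x \<in> K Zeros \<and> y \<in> K Zeros \<and> x = y + lat (-1) 1 1}"
  obtain B where B: "\<And>s x. x \<in> K s \<Longrightarrow> norm x \<le> B" using K_bounded by blast
  have *: "norm (x - rgt) \<le> (norm \<alpha> ^ 4) ^ n * (B + norm rgt)" if "x \<in> C" for n x
    using that
  proof (induction n arbitrary: x)
    case 0
    then have "norm x \<le> B" using B by (auto simp: C_def)
    then show ?case using norm_triangle_ineq4[of x rgt] by simp
  next
    case (Suc n)
    then obtain y where xy: "x \<in> K Zeros" "y \<in> K Zeros" "x = y + lat (-1) 1 1"
      by (auto simp: C_def)
    have "-1 + 1 * int a + 1 = int a" "\<bar>-1::int\<bar> \<le> 1" by auto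
    with xy obtain x1 y1 where 1: "x1 \<in> K (nxt a Zeros (a - 1))" "y1 \<in> K (nxt a Zeros 0)"
      "x = of_nat (a - 1) + \<alpha> * x1" "y = \<alpha> * y1" "x1 = y1 + lat 1 (- (- 1)) (- 1)"
      by (rule lat_step_up)
    have "x1 \<in> K Zeros" "y1 \<in> K Zeros" "x1 = y1 + lat 1 1 (- 1)" using 1 K_subset by auto
    then obtain x' y' where 2: "x' \<in> K Zeros" "y' \<in> K Zeros" "x' = y' + lat (-1) 1 1"
      "x1 = of_nat (a - 1) + \<alpha> * (\<alpha> * (\<alpha> * x'))"
      by (rule corner_cycle)
    have "x' \<in> C" using 2 by (auto simp: C_def)
    have "x - rgt = \<alpha> * (\<alpha> * (\<alpha> * (\<alpha> * (x' - rgt))))"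
      using rgt_expansion(1) unfolding 1(3) 2(4) by (simp add: algebra_simps)
    then have "norm (x - rgt) = norm \<alpha> ^ 4 * norm (x' - rgt)"
      by (simp add: norm_mult eval_nat_numeral)
    also have "\<dots> \<le> norm \<alpha> ^ 4 * ((norm \<alpha> ^ 4) ^ n * (B + norm rgt))"
      by (intro mult_left_mono Suc.IH \<open>x' \<in> C\<close>) auto
    finally show ?case by simp
  qed
  have "x \<in> C" using assms K_subset by (auto simp: C_def)
  have "norm \<alpha> ^ 4 < 1" using norm_alpha by (simp add: power_less_one_iff)
  then have "(\<lambda>n. (norm \<alpha> ^ 4) ^ n * (B + norm rgt)) \<longlonglongrightarrow> 0"
    by (intro tendsto_mult_left_zero LIMSEQ_power_zero) simp
  then have "norm (x - rgt) \<le> 0"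
    by (rule LIMSEQ_le_const) (use *[OF \<open>x \<in> C\<close>] in auto)
  then show ?thesis by simp
qed

lemma corner_plus:
  assumes "x \<in> K s1" "y \<in> K s2" "x = y + lat 1 1 (-1)"
  shows "x = rgt + c"
proof -
  have "x \<in> K Zeros" "y \<in> K Zeros" using assms K_subset by auto
  then obtain x' y' where *: "x' \<in> K Zeros" "y' \<in> K Zeros" "x' = y' + lat (-1) 1 1"
    "x = of_nat (a - 1) + \<alpha> * (\<alpha> * (\<alpha> * x'))"
    using assms(3) by (rule corner_cycle)
  then show ?thesis using corner_minus[OF *(1-3)] rgt_expansion(2) by simp
qed

end

section \<open>The boundary curve\<close>

context rauzy
begin

text \<open>The interval \<open>[i, i + 1]\<close> carries a reversed copy of the curve, scaled by \<open>\<alpha>^2\<close> for even and by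
  \<open>\<alpha>^3\<close> for odd \<open>i\<close>. For even \<open>i > 0\<close> only the part over \<open>[0, len - 2]\<close> is copied: there the digit
  before is nonzero, and the overlap shrinks from \<open>K Zeros \<inter> (K Zeros - c)\<close> to \<open>K Zero \<inter> (K Maxed - c)\<close>.\<close>

definition len :: real where "len = 2 * real a - 1"

definition stretch :: "nat \<Rightarrow> real" where
  "stretch i = (if i = 0 \<or> odd i then len else len - 2)"

definition place :: "nat \<Rightarrow> complex \<Rightarrow> complex" where
  "place i z = of_nat (i div 2) - c + \<alpha>^(2 + i mod 2) * z"

definition refine :: "(real \<Rightarrow> complex) \<Rightarrow> real \<Rightarrow> complex" where
  "refine g x = (let i = nat \<lfloor>x\<rfloor> in place i (g (stretch i * (real i + 1 - x))))"

text \<open>The value at \<open>len - 2\<close> is where a truncated copy, reversed, begins; without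
  it consecutive pieces of the refined curve would not join.\<close>

definition anchored :: "(real \<Rightarrow> complex) \<Rightarrow> bool" where
  "anchored g \<longleftrightarrow> continuous_on {0..len} g \<and> g 0 = lft \<and> g len = rgt \<and> g (len - 2) = rgt - 1"

lemma len_ge: "len \<ge> 5"
  using a_ge by (simp add: len_def)

lemma stretch_bounds: "3 \<le> stretch i" "stretch i \<le> len"
  using len_ge by (auto simp: stretch_def)

lemma stretch_arg:
  assumes "real i \<le> x" "x \<le> real i + 1"
  shows "stretch i * (real i + 1 - x) \<in> {0..len}"
    "even i \<Longrightarrow> i \<noteq> 0 \<Longrightarrow> stretch i * (real i + 1 - x) \<in> {0..len - 2}"
proof -
  have *: "stretch i * (real i + 1 - x) \<in> {0..stretch i}"
    using assms stretch_bounds(1)[of i] by (auto intro: mult_left_le)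
  then show "stretch i * (real i + 1 - x) \<in> {0..len}"
    using stretch_bounds(2)[of i] by auto
  show "even i \<Longrightarrow> i \<noteq> 0 \<Longrightarrow> stretch i * (real i + 1 - x) \<in> {0..len - 2}"
    using * by (auto simp: stretch_def)
qed

lemma alpha_alpha_c: "\<alpha> * (\<alpha> * c) = \<alpha> - \<alpha>^2"
  by (simp add: alpha_c algebra_simps power2_eq_square)

text \<open>Copies are reversed, so piece i ends at the image of \<open>lft\<close>. The next piece
  begins at the image of \<open>rgt\<close> if it is a full copy and of \<open>rgt - 1\<close> if it
  is truncated.\<close>

lemma place_lft:
  "even i \<Longrightarrow> place i lft = place (Suc i) rgt"
  "odd i \<Longrightarrow> place i lft = place (Suc i) (rgt - 1)"
proof -
  show "place i lft = place (Suc i) rgt" if ev: "even i"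
  proof -
    obtain d where "i = 2 * d" using ev by (rule evenE)
    then show ?thesis by (simp add: place_def lft_def power2_eq_square power3_eq_cube numeral_3_eq_3)
  qed
  have 1: "\<alpha>^2 * lft - \<alpha> * lft = 1 - \<alpha>"
  proof -
    have "\<alpha> * (\<alpha> * lft) = \<alpha> * lft + (1 - \<alpha>)"
      by (simp only: alpha_lft distrib_left alpha_c)
    then show ?thesis by (simp add: power2_eq_square mult.assoc)
  qed
  have 2: "\<alpha>^3 * lft = 1 + \<alpha>^2 * (rgt - 1)"
  proof -
    have "\<alpha>^3 * lft = \<alpha> * (\<alpha>^2 * lft)" by (simp add: eval_nat_numeral)
    also have "\<alpha>^2 * lft = \<alpha> * lft + 1 - \<alpha>" using 1 by (simp add: algebra_simps)
    also have "\<alpha> * (\<alpha> * lft + 1 - \<alpha>) = \<alpha>^2 * lft + \<alpha> - \<alpha>^2"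
      by (simp add: algebra_simps power2_eq_square)
    finally have L: "\<alpha>^3 * lft = \<alpha>^2 * lft + \<alpha> - \<alpha>^2" .
    have "\<alpha>^2 * h = \<alpha> * (\<alpha> * h)" by (simp add: power2_eq_square)
    also have "\<dots> = \<alpha> - 1" by (simp add: alpha_h alpha_c)
    finally have "\<alpha>^2 * h = \<alpha> - 1" .
    then show ?thesis unfolding L rgt_eq by (simp add: algebra_simps)
  qed
  show "place i lft = place (Suc i) (rgt - 1)" if od: "odd i"
  proof -
    obtain d where "i = 2 * d + 1" using od by (rule oddE)
    then have "i div 2 = d" "i mod 2 = 1" "Suc i div 2 = Suc d" "Suc i mod 2 = 0" by presburger+
    then show ?thesis
      using 2 by (simp add: place_def algebra_simps power2_eq_square power3_eq_cube)
  qed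
qed

lemma place_rgt_0: "place 0 rgt = lft"
proof -
  have "\<alpha>^2 * rgt = \<alpha> * lft" by (simp add: lft_def power2_eq_square)
  then show ?thesis by (simp add: place_def alpha_lft)
qed

text \<open>For d = a - 1 and d = a - 2 these are the prescribed values at \<open>len\<close> and
  \<open>len - 2\<close>, so refinement preserves \<open>anchored\<close>.\<close>

lemma place_end: "place (2 * d) lft = rgt - of_nat a + 1 + of_nat d"
proof -
  have "\<alpha>^2 * lft = \<alpha> * (\<alpha> * lft)" by (simp add: power2_eq_square)
  also have "\<dots> = lft + c + 1 - \<alpha>" by (simp add: alpha_lft distrib_left alpha_c)
  finally show ?thesis by (simp add: place_def rgt_eq h_def)
qed

text \<open>At x = i + 1 the floor in \<open>refine\<close> selects piece i + 1;
  \<open>place_lft\<close> makes the formula of piece i valid there as well.\<close>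

lemma refine_eq:
  assumes "anchored g" "real i \<le> x" "x \<le> real i + 1"
  shows "refine g x = place i (g (stretch i * (real i + 1 - x)))"
proof (cases "x < real i + 1")
  case True
  then have "\<lfloor>x\<rfloor> = int i" using assms(2) by (intro floor_unique) auto
  then show ?thesis by (simp add: refine_def)
next
  case False
  then have x: "x = real (Suc i)" using assms(3) by simp
  have "refine g x = place (Suc i) (g (stretch (Suc i)))"
    by (simp add: refine_def x nat_add_distrib)
  also have "\<dots> = place i lft"
    using assms(1) place_lft[of i] by (cases "even i") (auto simp: stretch_def anchored_def)
  finally show ?thesis using assms(1) by (simp add: x anchored_def)
qed

lemma unit_interval_cover:
  assumes "0 \<le> x" "x \<le> real n" "0 < n"
  obtains i where "i < n" "real i \<le> x" "x \<le> real i + 1"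
proof (cases "x = real n")
  case True
  then show ?thesis using assms(3) by (intro that[of "n - 1"]) auto
next
  case False
  then have "nat \<lfloor>x\<rfloor> < n" "real (nat \<lfloor>x\<rfloor>) \<le> x" "x \<le> real (nat \<lfloor>x\<rfloor>) + 1"
    using assms by (auto simp: nat_less_iff floor_less_iff)
  then show ?thesis by (rule that)
qed

lemma len_nat: "len = real (2 * a - 1)" "len - 2 = real (2 * a - 3)"
  using a_ge by (auto simp: len_def)

lemma anchored_refine:
  assumes g: "anchored g"
  shows "anchored (refine g)"
  unfolding anchored_def
proof (intro conjI)
  have cont: "continuous_on {real i..real i + 1} (refine g)" for i
  proof -
    have "continuous_on {real i..real i + 1} (\<lambda>x. g (stretch i * (real i + 1 - x)))"
    proof (rule continuous_on_compose2[of "{0..len}" g])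
      show "continuous_on {0..len} g" using g by (simp add: anchored_def)
      show "(\<lambda>x. stretch i * (real i + 1 - x)) ` {real i..real i + 1} \<subseteq> {0..len}"
        using stretch_arg(1)[of i] by auto
    qed (intro continuous_intros)
    then have "continuous_on {real i..real i + 1} (\<lambda>x. place i (g (stretch i * (real i + 1 - x))))"
      unfolding place_def by (intro continuous_intros)
    then show ?thesis
      by (rule continuous_on_eq) (auto simp: refine_eq[OF g])
  qed
  have "{0..len} \<subseteq> (\<Union>i<2 * a - 1. {real i..real i + 1})"
  proof
    fix x assume "x \<in> {0..len}"
    then have "0 \<le> x" "x \<le> real (2 * a - 1)" "0 < 2 * a - 1" using a_ge len_nat by auto
    then obtain i where "i < 2 * a - 1" "real i \<le> x" "x \<le> real i + 1" by (rule unit_interval_cover)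
    then show "x \<in> (\<Union>i<2 * a - 1. {real i..real i + 1})" by auto
  qed
  moreover have "continuous_on (\<Union>i<2 * a - 1. {real i..real i + 1}) (refine g)"
    using cont by (intro continuous_on_closed_Union) auto
  ultimately show "continuous_on {0..len} (refine g)" by (rule continuous_on_subset[rotated])
  have g0: "g 0 = lft" "g len = rgt" using g by (auto simp: anchored_def)
  have end_pt: "refine g (real (2 * d) + 1) = rgt - of_nat a + 1 + of_nat d" for d
    using refine_eq[OF g, of "2 * d" "real (2 * d) + 1"] by (simp add: g0 place_end)
  show "refine g 0 = lft"
    using refine_eq[OF g, of 0 0] by (simp add: stretch_def g0 place_rgt_0)
  have "len = real (2 * (a - 1)) + 1" using a_ge by (simp add: len_def of_nat_diff)
  then show "refine g len = rgt" using end_pt[of "a - 1"] a_ge by (simp add: of_nat_diff)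
  have "real (2 * (a - 2)) + 1 = len - 2" using a_ge by (simp add: len_def of_nat_diff)
  from end_pt[of "a - 2", unfolded this] show "refine g (len - 2) = rgt - 1"
    using a_ge by (simp add: of_nat_diff)
qed

lemma anchored_exists: "\<exists>g. anchored g"
proof -
  \<comment> \<open>Linear interpolation gives both ends. The correction x (len - x) k vanishes
    there, and at \<open>len - 2\<close> its factor is 2 (len - 2), which determines k.\<close>
  define k where "k = (2 * h / of_real len - 1) / of_real (2 * (len - 2))"
  define g where "g x = lft + of_real (x / len) * h + of_real (x * (len - x)) * k" for x
  have "continuous_on {0..len} g" unfolding g_def using len_ge by (intro continuous_intros) auto
  moreover have "g 0 = lft" "g len = rgt" using len_ge by (auto simp: g_def rgt_eq)
  moreover have "g (len - 2) = rgt - 1"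
  proof -
    have "of_real ((len - 2) * (len - (len - 2))) * k = 2 * h / of_real len - 1"
      using len_ge by (simp add: k_def mult.commute del: of_real_diff)
    moreover have "of_real ((len - 2) / len) * h = h - 2 * h / of_real len"
      using len_ge by (simp add: field_simps)
    ultimately show ?thesis by (simp add: g_def rgt_eq)
  qed
  ultimately show ?thesis unfolding anchored_def by blast
qed

text \<open>Picard iteration of \<open>refine\<close>: consecutive iterates approach each other by
  the factor |\<alpha>|^2, so the telescoping series converges uniformly and the limit inherits the
  anchors and the piece equations.\<close>

lemma curve_exists:
  "\<exists>f. anchored f \<and> (\<forall>i. \<forall>x\<in>{0..len}. real i \<le> x \<longrightarrow> x \<le> real i + 1 \<longrightarrow>
     f x = place i (f (stretch i * (real i + 1 - x))))"
proof -
  obtain g where g: "anchored g" using anchored_exists by blast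
  define it where "it n = (refine ^^ n) g" for n
  have it_Suc: "it (Suc n) = refine (it n)" for n
    by (simp add: it_def)
  have it_0: "it 0 = g"
    by (simp add: it_def)
  have it: "anchored (it n)" for n
    by (induction n) (auto simp: it_def g anchored_refine)
  define D where "D n x = it (Suc n) x - it n x" for n x
  have "compact (D 0 ` {0..len})"
    unfolding D_def using it[of 0] it[of "Suc 0"]
    by (intro compact_continuous_image continuous_intros) (auto simp: anchored_def)
  then have "bounded (D 0 ` {0..len})" by (rule compact_imp_bounded)
  then obtain C where C: "\<And>x. x \<in> {0..len} \<Longrightarrow> norm (D 0 x) \<le> C"
    unfolding bounded_iff by blast
  define r where "r = norm \<alpha> ^ 2"
  have r: "0 \<le> r" "r < 1" using norm_alpha by (auto simp: r_def power_less_one_iff)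
  have D: "norm (D n x) \<le> C * r ^ n" if "x \<in> {0..len}" for n x
    using that
  proof (induction n arbitrary: x)
    case 0
    then show ?case using C by simp
  next
    case (Suc n)
    define i where "i = nat \<lfloor>x\<rfloor>"
    define y where "y = stretch i * (real i + 1 - x)"
    have i: "real i \<le> x" "x \<le> real i + 1" using Suc.prems by (auto simp: i_def)
    have y: "y \<in> {0..len}" unfolding y_def using i by (rule stretch_arg)
    have "D (Suc n) x = refine (it (Suc n)) x - refine (it n) x"
      by (simp only: D_def it_Suc)
    also have "\<dots> = place i (it (Suc n) y) - place i (it n y)"
      by (simp only: refine_eq[OF it i] y_def)
    also have "\<dots> = \<alpha> ^ (2 + i mod 2) * D n y" by (simp add: place_def D_def algebra_simps)
    finally have "norm (D (Suc n) x) = norm \<alpha> ^ (2 + i mod 2) * norm (D n y)"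
      by (simp add: norm_mult norm_power)
    also have "\<dots> \<le> r * (C * r ^ n)"
    proof (intro mult_mono Suc.IH y)
      show "norm \<alpha> ^ (2 + i mod 2) \<le> r"
        unfolding r_def using norm_alpha by (intro power_decreasing) auto
    qed (use r in auto)
    finally show ?case by (simp add: mult_ac)
  qed
  define f where "f x = g x + (\<Sum>n. D n x)" for x
  have "uniform_limit {0..len} (\<lambda>n x. \<Sum>i<n. D i x) (\<lambda>x. \<Sum>n. D n x) sequentially"
  proof (rule Weierstrass_m_test)
    show "summable (\<lambda>n. C * r ^ n)" using r by (intro summable_mult summable_geometric) auto
  qed (use D in auto)
  then have "uniform_limit {0..len} (\<lambda>n x. g x + (\<Sum>i<n. D i x)) f sequentially"
    unfolding f_def by (intro uniform_limit_intros)
  moreover have "g x + (\<Sum>i<n. D i x) = it n x" for n x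
    by (induction n) (simp_all add: D_def it_0 algebra_simps)
  ultimately have lim: "uniform_limit {0..len} it f sequentially" by simp
  have "continuous_on {0..len} f"
    using it by (intro uniform_limit_theorem[OF _ lim]) (auto simp: anchored_def)
  have pw: "(\<lambda>n. it n x) \<longlonglongrightarrow> f x" if "x \<in> {0..len}" for x
    using lim that by (rule tendsto_uniform_limitI)
  have pts: "0 \<in> {0..len}" "len \<in> {0..len}" "len - 2 \<in> {0..len}" using len_ge by auto
  have "f 0 = lft" "f len = rgt" "f (len - 2) = rgt - 1"
    using pw[OF pts(1)] pw[OF pts(2)] pw[OF pts(3)] it
    by (auto simp: anchored_def LIMSEQ_const_iff)
  with \<open>continuous_on {0..len} f\<close> have "anchored f" by (simp add: anchored_def)
  moreover have "f x = place i (f (stretch i * (real i + 1 - x)))"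
    if "x \<in> {0..len}" "real i \<le> x" "x \<le> real i + 1" for i x
  proof (rule LIMSEQ_unique)
    show "(\<lambda>n. it (Suc n) x) \<longlonglongrightarrow> f x" using pw[OF that(1)] by (rule LIMSEQ_Suc)
    have "(\<lambda>n. it n (stretch i * (real i + 1 - x))) \<longlonglongrightarrow> f (stretch i * (real i + 1 - x))"
      using that(2,3) by (intro pw stretch_arg)
    then have "(\<lambda>n. place i (it n (stretch i * (real i + 1 - x)))) \<longlonglongrightarrow> place i (f (stretch i * (real i + 1 - x)))"
      unfolding place_def by (intro tendsto_intros)
    then show "(\<lambda>n. it (Suc n) x) \<longlonglongrightarrow> place i (f (stretch i * (real i + 1 - x)))"
    proof -
      have "it (Suc n) x = place i (it n (stretch i * (real i + 1 - x)))" for n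
        using refine_eq[OF it that(2,3), of n] by (simp add: it_Suc)
      then show ?thesis using \<open>_ \<longlonglongrightarrow> place i _\<close> by presburger
    qed
  qed
  ultimately show ?thesis by blast
qed

definition curve :: "real \<Rightarrow> complex" where
  "curve = (SOME f. anchored f \<and> (\<forall>i. \<forall>x\<in>{0..len}. real i \<le> x \<longrightarrow> x \<le> real i + 1 \<longrightarrow>
     f x = place i (f (stretch i * (real i + 1 - x)))))"

lemma anchored_curve: "anchored curve"
  and curve_eq: "x \<in> {0..len} \<Longrightarrow> real i \<le> x \<Longrightarrow> x \<le> real i + 1 \<Longrightarrow>
     curve x = place i (curve (stretch i * (real i + 1 - x)))"
  using someI_ex[OF curve_exists] unfolding curve_def[symmetric] by blast+

lemma curve_ends: "curve 0 = lft" "curve len = rgt" "curve (len - 2) = rgt - 1"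
  and continuous_curve: "continuous_on {0..len} curve"
  using anchored_curve by (auto simp: anchored_def)

lemma curve_piece:
  assumes "x \<in> {0..real n}" "0 < n" "real n \<le> len"
  obtains i y where "i < n" "real i \<le> x" "x \<le> real i + 1" "y = stretch i * (real i + 1 - x)"
    "curve x = place i (curve y)" "y \<in> {0..len}" "even i \<and> i \<noteq> 0 \<longrightarrow> y \<in> {0..len - 2}"
proof -
  obtain i where i: "i < n" "real i \<le> x" "x \<le> real i + 1"
    using assms(1,2) by (auto elim: unit_interval_cover)
  have "x \<in> {0..len}" using assms by auto
  show thesis
    using stretch_arg[OF i(2,3)]
    by (intro that[OF i refl curve_eq[OF \<open>x \<in> {0..len}\<close> i(2,3)]]) auto
qed

section \<open>Digit expansions of the curve points\<close>

lemma of_nat_digit: "of_nat (a - 1) = (of_nat a - 1 :: complex)" "of_nat (a - 2) = (of_nat a - 2 :: complex)"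
  using a_ge by (simp_all add: of_nat_diff)

text \<open>A point of an even piece starts with i/2, a - 1 and continues with z + c, while its
  translate by c starts with i/2, 0 and continues with z. Membership of the pair z, z + c thus
  passes to the image pair.\<close>

lemma place_even_digits:
  assumes "even i"
  shows "place i z = of_nat (i div 2) + \<alpha> * (of_nat (a - 1) + \<alpha> * (z + c))"
    "place i z + c = of_nat (i div 2) + \<alpha> * (of_nat 0 + \<alpha> * z)"
proof -
  have "\<alpha> * h = - c" by (rule alpha_h)
  then have "of_nat a * \<alpha> - \<alpha>^2 = - c" by (simp add: h_def algebra_simps power2_eq_square)
  moreover have "\<alpha> * (of_nat (a - 1) + \<alpha> * (z + c)) = of_nat a * \<alpha> - \<alpha> + \<alpha>^2 * z + \<alpha> * (\<alpha> * c)"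
    unfolding of_nat_digit by (simp add: algebra_simps power2_eq_square)
  ultimately show "place i z = of_nat (i div 2) + \<alpha> * (of_nat (a - 1) + \<alpha> * (z + c))"
    using assms unfolding of_nat_digit by (simp add: place_def alpha_alpha_c algebra_simps)
  show "place i z + c = of_nat (i div 2) + \<alpha> * (of_nat 0 + \<alpha> * z)"
    using assms by (simp add: place_def power2_eq_square)
qed

text \<open>The same for odd pieces, where the two first digits differ by one and a third digit, a -
  2 against 0, is needed before the pair z + c, z reappears.\<close>

lemma place_odd_digits:
  assumes "odd i"
  shows "place i z = of_nat (Suc (i div 2)) + \<alpha> * (of_nat (a - 1) + \<alpha> * (of_nat (a - 2) + \<alpha> * (z + c)))"
    "place i z + c = of_nat (i div 2) + \<alpha> * (of_nat 0 + \<alpha> * (of_nat 0 + \<alpha> * z))"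
proof -
  have 0: "i mod 2 = 1" using assms by (simp add: odd_iff_mod_2_eq_one)
  have "\<alpha> * h = - c" by (rule alpha_h)
  then have 1: "of_nat a * \<alpha> - \<alpha>^2 = - c" by (simp add: h_def algebra_simps power2_eq_square)
  have 2: "\<alpha>^3 = of_nat a * \<alpha>^2 - \<alpha> + 1" by (rule alpha_cubic)
  have "\<alpha> * (of_nat (a - 1) + \<alpha> * (of_nat (a - 2) + \<alpha> * (z + c)))
      = of_nat a * \<alpha> - \<alpha> + of_nat a * \<alpha>^2 - 2 * \<alpha>^2 + \<alpha>^3 * z + \<alpha> * (\<alpha> * (\<alpha> * c))"
    unfolding of_nat_digit by (simp add: algebra_simps eval_nat_numeral)
  also have "\<alpha> * (\<alpha> * (\<alpha> * c)) = \<alpha>^2 - \<alpha>^3"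
    unfolding alpha_alpha_c by (simp add: algebra_simps eval_nat_numeral)
  also have "of_nat a * \<alpha> - \<alpha> + of_nat a * \<alpha>^2 - 2 * \<alpha>^2 + \<alpha>^3 * z + (\<alpha>^2 - \<alpha>^3) = - c - 1 + \<alpha>^3 * z"
    using 1 2 by algebra
  finally show "place i z = of_nat (Suc (i div 2)) + \<alpha> * (of_nat (a - 1) + \<alpha> * (of_nat (a - 2) + \<alpha> * (z + c)))"
    using 0 by (simp add: place_def)
  show "place i z + c = of_nat (i div 2) + \<alpha> * (of_nat 0 + \<alpha> * (of_nat 0 + \<alpha> * z))"
    using 0 by (simp add: place_def eval_nat_numeral)
qed

definition prefix :: "(state \<Rightarrow> complex set) \<Rightarrow> state \<Rightarrow> complex set" where
  "prefix B s = {of_nat k + \<alpha> * y | k y. allowed a s k \<and> y \<in> B (nxt a s k)}"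

lemma prefixI: "allowed a s k \<Longrightarrow> y \<in> B (nxt a s k) \<Longrightarrow> of_nat k + \<alpha> * y \<in> prefix B s"
  unfolding prefix_def by blast

lemma prefix_mono: "(\<And>s. E s \<subseteq> F s) \<Longrightarrow> prefix E s \<subseteq> prefix F s"
  unfolding prefix_def by auto

text \<open>Pieces consume two or three digits at once; adding the families with one or two digits
  prefixed reduces this to steps of one digit.\<close>

lemma K_coinduct_prefix:
  assumes bnd: "\<And>s x. x \<in> B s \<Longrightarrow> norm x \<le> C"
    and step: "\<And>s. B s \<subseteq> prefix (prefix B) s \<union> prefix (prefix (prefix B)) s"
  shows "B s \<subseteq> K s"
proof -
  define X where "X s = B s \<union> prefix B s \<union> prefix (prefix B) s" for s
  have pb: "norm x \<le> D + real a" if "\<And>s x. x \<in> E s \<Longrightarrow> norm x \<le> D" and x: "x \<in> prefix E s" for E D s x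
  proof -
    obtain k y where ky: "allowed a s k" "y \<in> E (nxt a s k)" "x = of_nat k + \<alpha> * y"
      using x by (auto simp: prefix_def)
    have "norm (\<alpha> * y) \<le> norm y"
      using norm_alpha by (simp add: norm_mult mult_left_le_one_le)
    moreover have "norm x \<le> norm (of_nat k :: complex) + norm (\<alpha> * y)"
      unfolding ky(3) by (rule norm_triangle_ineq)
    moreover have "k < a" using ky(1) by (simp add: allowed_def)
    ultimately show ?thesis using that(1)[OF ky(2)] by simp
  qed
  have pb1: "norm x \<le> C + real a" if "x \<in> prefix B s" for s x
    using bnd that by (rule pb)
  have pb2: "norm x \<le> C + real a + real a" if "x \<in> prefix (prefix B) s" for s x
    using pb1 that by (rule pb)
  have "X s \<subseteq> K s"
  proof (rule K_coinduct)
    show "norm x \<le> C + real a + real a" if xX: "x \<in> X s" for s x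
    proof -
      consider "x \<in> B s" | "x \<in> prefix B s" | "x \<in> prefix (prefix B) s"
        using xX by (auto simp: X_def)
      then show ?thesis
      proof cases
        case 1
        then show ?thesis using bnd[OF 1] by simp
      next
        case 2
        then show ?thesis using pb1[OF 2] by simp
      next
        case 3
        then show ?thesis by (rule pb2)
      qed
    qed
    have X_prefix: "X s \<subseteq> prefix X s" for s
    proof -
      have "prefix B s \<subseteq> prefix X s" "prefix (prefix B) s \<subseteq> prefix X s"
        "prefix (prefix (prefix B)) s \<subseteq> prefix X s"
        by (rule prefix_mono; auto simp: X_def)+
      then show ?thesis using step[of s] unfolding X_def[of s] by auto
    qed
    then show "\<exists>k y. allowed a s k \<and> y \<in> X (nxt a s k) \<and> x = of_nat k + \<alpha> * y" if "x \<in> X s" for s x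
    proof -
      have "x \<in> prefix X s" using X_prefix that by auto
      then show ?thesis unfolding prefix_def by auto
    qed
  qed
  then show ?thesis by (auto simp: X_def)
qed

text \<open>One coinduction for all four states. In an even piece with i > 0 the nonzero first digit
  makes the following a - 1 lead to \<open>Maxed\<close>, and the 0 of the translate lead to
  \<open>Zero\<close>; this is why only the part over \<open>{0..len - 2}\<close> is copied
  there.\<close>

lemma curve_in_K:
  "x \<in> {0..len} \<Longrightarrow> curve x \<in> K Zeros" "x \<in> {0..len} \<Longrightarrow> curve x + c \<in> K Digit"
  "x \<in> {0..len - 2} \<Longrightarrow> curve x \<in> K Zero" "x \<in> {0..len - 2} \<Longrightarrow> curve x + c \<in> K Maxed"
proof -
  define B where "B s = (case s of Zeros \<Rightarrow> curve ` {0..len} | Zero \<Rightarrow> curve ` {0..len - 2}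
    | Digit \<Rightarrow> (\<lambda>x. curve x + c) ` {0..len} | Maxed \<Rightarrow> (\<lambda>x. curve x + c) ` {0..len - 2})" for s
  have "bounded (curve ` {0..len})"
    by (intro compact_imp_bounded compact_continuous_image continuous_curve) simp
  then obtain C where C: "\<And>x. x \<in> {0..len} \<Longrightarrow> norm (curve x) \<le> C"
    unfolding bounded_iff by blast
  have bnd: "norm z \<le> C + norm c" if "z \<in> B s" for s z
  proof -
    have "\<exists>x\<in>{0..len}. z = curve x \<or> z = curve x + c"
      using that by (cases s) (force simp: B_def)+
    then obtain x where x: "x \<in> {0..len}" "z = curve x \<or> z = curve x + c" by blast
    have "norm z \<le> norm (curve x) + norm c"
      using x(2) norm_triangle_ineq[of "curve x" c] by auto
    then show ?thesis using C[OF x(1)] by simp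
  qed
  have step1: "curve x \<in> prefix (prefix B) Zeros \<union> prefix (prefix (prefix B)) Zeros \<and>
      curve x + c \<in> prefix (prefix B) Digit \<union> prefix (prefix (prefix B)) Digit" if x: "x \<in> {0..len}" for x
  proof -
    have "x \<in> {0..real (2 * a - 1)}" "0 < 2 * a - 1" "real (2 * a - 1) \<le> len" using x a_ge len_nat by auto
    then obtain i y where iy: "i < 2 * a - 1" "real i \<le> x" "x \<le> real i + 1"
      "y = stretch i * (real i + 1 - x)" "curve x = place i (curve y)" "y \<in> {0..len}"
      "even i \<and> i \<noteq> 0 \<longrightarrow> y \<in> {0..len - 2}" by (rule curve_piece)
    note i = iy(1,5-7)
    show ?thesis
    proof (cases "even i")
      case True
      have "i div 2 < a" using i(1) by linarith
      have "y \<in> {0..len - 2}" if "i div 2 \<noteq> 0" using i(4) True that by (auto simp: div_eq_0_iff)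
      note y = this \<open>i div 2 < a\<close> a_ge i(3)
      have "place i (curve y) \<in> prefix (prefix B) Zeros"
        unfolding place_even_digits(1)[OF True]
        by (intro prefixI) (use y in \<open>auto simp: allowed_def nxt_def B_def\<close>)
      moreover have "place i (curve y) + c \<in> prefix (prefix B) Digit"
        unfolding place_even_digits(2)[OF True]
        by (intro prefixI) (use y in \<open>auto simp: allowed_def nxt_def B_def\<close>)
      ultimately show ?thesis using i(2) by simp
    next
      case False
      have "Suc (i div 2) < a" using i(1) False by presburger
      note y = this a_ge i(3)
      have "place i (curve y) \<in> prefix (prefix (prefix B)) Zeros"
        unfolding place_odd_digits(1)[OF False]
        by (intro prefixI) (use y in \<open>auto simp: allowed_def nxt_def B_def\<close>)
      moreover have "place i (curve y) + c \<in> prefix (prefix (prefix B)) Digit"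
        unfolding place_odd_digits(2)[OF False]
        by (intro prefixI) (use y in \<open>auto simp: allowed_def nxt_def B_def\<close>)
      ultimately show ?thesis using i(2) by simp
    qed
  qed
  have step2: "curve x \<in> prefix (prefix B) Zero \<union> prefix (prefix (prefix B)) Zero \<and>
      curve x + c \<in> prefix (prefix B) Maxed \<union> prefix (prefix (prefix B)) Maxed" if x: "x \<in> {0..len - 2}" for x
  proof -
    have "x \<in> {0..real (2 * a - 3)}" "0 < 2 * a - 3" "real (2 * a - 3) \<le> len" using x a_ge len_nat by auto
    then obtain i y where iy: "i < 2 * a - 3" "real i \<le> x" "x \<le> real i + 1"
      "y = stretch i * (real i + 1 - x)" "curve x = place i (curve y)" "y \<in> {0..len}"
      "even i \<and> i \<noteq> 0 \<longrightarrow> y \<in> {0..len - 2}" by (rule curve_piece)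
    note i = iy(1,5-7)
    show ?thesis
    proof (cases "even i")
      case True
      have "i div 2 < a - 1" using i(1) by linarith
      have "y \<in> {0..len - 2}" if "i div 2 \<noteq> 0" using i(4) True that by (auto simp: div_eq_0_iff)
      note y = this \<open>i div 2 < a - 1\<close> a_ge i(3)
      have "place i (curve y) \<in> prefix (prefix B) Zero"
        unfolding place_even_digits(1)[OF True]
        by (intro prefixI) (use y in \<open>auto simp: allowed_def nxt_def B_def\<close>)
      moreover have "place i (curve y) + c \<in> prefix (prefix B) Maxed"
        unfolding place_even_digits(2)[OF True]
        by (intro prefixI) (use y in \<open>auto simp: allowed_def nxt_def B_def\<close>)
      ultimately show ?thesis using i(2) by simp
    next
      case False
      have "Suc (i div 2) < a - 1" using i(1) False by presburger
      note y = this a_ge i(3)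
      have "place i (curve y) \<in> prefix (prefix (prefix B)) Zero"
        unfolding place_odd_digits(1)[OF False]
        by (intro prefixI) (use y in \<open>auto simp: allowed_def nxt_def B_def\<close>)
      moreover have "place i (curve y) + c \<in> prefix (prefix (prefix B)) Maxed"
        unfolding place_odd_digits(2)[OF False]
        by (intro prefixI) (use y in \<open>auto simp: allowed_def nxt_def B_def\<close>)
      ultimately show ?thesis using i(2) by simp
    qed
  qed
  have B: "B Zeros = curve ` {0..len}" "B Zero = curve ` {0..len - 2}"
    "B Digit = (\<lambda>x. curve x + c) ` {0..len}" "B Maxed = (\<lambda>x. curve x + c) ` {0..len - 2}"
    by (simp_all add: B_def)
  have "B s \<subseteq> prefix (prefix B) s \<union> prefix (prefix (prefix B)) s" for s
    by (cases s; simp only: B; use step1 step2 in blast)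
  with bnd have "B s \<subseteq> K s" for s by (rule K_coinduct_prefix)
  from this[of Zeros] this[of Digit] this[of Zero] this[of Maxed] show
    "x \<in> {0..len} \<Longrightarrow> curve x \<in> K Zeros" "x \<in> {0..len} \<Longrightarrow> curve x + c \<in> K Digit"
    "x \<in> {0..len - 2} \<Longrightarrow> curve x \<in> K Zero" "x \<in> {0..len - 2} \<Longrightarrow> curve x + c \<in> K Maxed"
    by (auto simp: B_def)
qed

end

section \<open>Overlaps of neighbouring tiles lie on the curve\<close>

context rauzy
begin

lemma lat_minus_c: "x = (x + c) + lat (-1) 0 1" and lat_c: "y + lat 1 0 (-1) = y + c"
  by (simp_all add: lat_def c_def)

text \<open>A second expansion of the starting point of an odd piece, with a - 2 as second digit; it
  is the one met when the digit comparison runs into a corner.\<close>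

lemma place_odd_rgt:
  assumes "1 \<le> k"
  shows "place (2 * k - 1) rgt = of_nat k + \<alpha> * (of_nat (a - 2) + \<alpha> * (rgt + c))"
proof -
  have i: "odd (2 * k - 1)" "Suc ((2 * k - 1) div 2) = k" using assms by presburger+
  have 1: "\<alpha> * rgt = lft" by (simp add: lft_def)
  have e1: "\<alpha> * (rgt + c) = lft + 1 - \<alpha>" by (simp only: distrib_left 1 alpha_c) simp
  have "\<alpha> * (lft + 1 - \<alpha>) = lft + c + \<alpha> - \<alpha>^2"
    by (simp only: distrib_left right_diff_distrib alpha_lft power2_eq_square) simp
  moreover have "of_nat a * \<alpha> - \<alpha>^2 = - c"
    using alpha_h by (simp add: h_def algebra_simps power2_eq_square)
  ultimately have "of_nat (a - 1) + \<alpha> * (of_nat (a - 2) + \<alpha> * (rgt + c)) = of_nat (a - 2) + \<alpha> * (rgt + c)"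
    unfolding of_nat_digit e1 by algebra
  then show ?thesis unfolding place_odd_digits(1)[OF i(1)] i(2) by simp
qed

text \<open>Converse of the digit expansions of the pieces. Equal first digits lead to the even
  piece 2k; first digits k and k - 1 lead to the odd piece 2k - 1 or to its starting point. The
  states decide which pieces occur and which smaller overlap contains y.\<close>

lemma overlap_step:
  assumes s: "s1 = Zeros \<and> s2 = Zeros \<and> n = 2 * a - 1 \<or> s1 = Zero \<and> s2 = Maxed \<and> n = 2 * a - 3"
    and x: "x \<in> K s1" "x + c \<in> K s2"
  shows "x \<in> curve ` {0..real n} \<or> (\<exists>i<n. \<exists>y. x = place i y \<and> y \<in> K Zeros \<and> y + c \<in> K Zeros \<and>
    (even i \<and> i \<noteq> 0 \<longrightarrow> y \<in> K Zero \<and> y + c \<in> K Maxed))"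
proof -
  obtain k x1 l w1 where 1: "allowed a s1 k" "x1 \<in> K (nxt a s1 k)" "x = of_nat k + \<alpha> * x1"
    "allowed a s2 l" "w1 \<in> K (nxt a s2 l)" "x + c = of_nat l + \<alpha> * w1"
    "x1 = w1 + lat (-1 + 0 * int a + 1 + int l - int k) (- (-1)) (- 0)"
    using x lat_minus_c by (rule lat_step)
  have x1: "x1 = w1 + lat (int l - int k) 1 0" using 1(7) by simp
  have "\<bar>int l - int k\<bar> \<le> 1" by (rule lat_v_le[OF 1(2,5) x1]) simp
  moreover have "\<not> int l - int k \<ge> 1" using lat_hv_False[OF 1(2,5) x1] by auto
  ultimately consider "l = k" | "k = Suc l" by linarith
  then show ?thesis
  proof cases
    case l: 1
    have "x1 = w1 + lat 0 1 0" using x1 l by simp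
    from lat_step_up[OF 1(2,5) this] obtain x2 w2 where 2: "x2 \<in> K (nxt a (nxt a s1 k) (a - 1))"
      "w2 \<in> K (nxt a (nxt a s2 l) 0)" "x1 = of_nat (a - 1) + \<alpha> * x2" "w1 = \<alpha> * w2"
      "x2 = w2 + lat 1 (- 0) (- 1)" by auto
    have x2: "x2 = w2 + c" using 2(5) lat_c[of w2] by simp
    have "x = place (2 * k) w2"
      by (simp add: place_even_digits(1) 1(3) 2(3) x2)
    moreover have "2 * k < n" using s 1(1,4) l by (auto simp: allowed_def)
    moreover have "w2 \<in> K Zeros" "w2 + c \<in> K Zeros" using 2(1,2) x2 K_subset by auto
    moreover have "w2 \<in> K Zero \<and> w2 + c \<in> K Maxed" if "k \<noteq> 0"
      using 2(1,2) x2 that s 1(1,4) l a_ge by (auto simp: nxt_def allowed_def split: if_splits)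
    ultimately show ?thesis by (intro disjI2 exI[of _ "2 * k"] conjI exI[of _ w2]) auto
  next
    case l: 2
    have s1: "nxt a s1 k = Digit \<or> nxt a s1 k = Maxed" using s l by (auto simp: nxt_def)
    have "x1 = w1 + lat (-1) 1 0" using x1 l by simp
    with 1(2,5) obtain k1 x2 l1 w2 where 2: "allowed a (nxt a s1 k) k1" "x2 \<in> K (nxt a (nxt a s1 k) k1)"
      "x1 = of_nat k1 + \<alpha> * x2" "allowed a (nxt a s2 l) l1" "w2 \<in> K (nxt a (nxt a s2 l) l1)"
      "w1 = of_nat l1 + \<alpha> * w2" "x2 = w2 + lat (-1 + 1 * int a + 0 + int l1 - int k1) (- (-1)) (- 1)"
      by (rule lat_step)
    define p where "p = int a - 1 + int l1 - int k1"
    have x2: "x2 = w2 + lat p 1 (-1)" using 2(7) by (simp add: p_def algebra_simps)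
    have "\<bar>p\<bar> \<le> 1" by (rule lat_v_le[OF 2(2,5) x2]) simp
    moreover have "0 \<le> p" using 2(1) by (auto simp: p_def allowed_def)
    moreover have k1_Maxed: "nxt a s1 k = Digit \<and> x2 \<in> K Maxed" if "k1 = a - 1"
      using that 2(1,2) s1 a_ge by (auto simp: nxt_def allowed_def split: if_splits)
    ultimately consider "p = 0" | "p = 1" by linarith
    then show ?thesis
    proof cases
      case p: 1
      have k1: "k1 = a - 1" using p 2(1) by (auto simp: p_def allowed_def)
      have "x2 = w2 + lat 0 1 (-1)" using x2 p by simp
      with k1_Maxed[OF k1, THEN conjunct2] 2(5) obtain k2 x3 l2 w3 where 3: "allowed a Maxed k2"
        "x3 \<in> K (nxt a Maxed k2)" "x2 = of_nat k2 + \<alpha> * x3"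
        "allowed a (nxt a (nxt a s2 l) l1) l2" "w3 \<in> K (nxt a (nxt a (nxt a s2 l) l1) l2)"
        "w2 = of_nat l2 + \<alpha> * w3" "x3 = w3 + lat (0 + 1 * int a + -1 + int l2 - int k2) (- 0) (- 1)"
        by (rule lat_step)
      have "\<bar>0 + 1 * int a + -1 + int l2 - int k2\<bar> \<le> 1"
        by (rule lat_v_le[OF 3(2,5,7)]) simp
      moreover have "k2 < a - 1" using 3(1) by (auto simp: allowed_def)
      ultimately have k2: "k2 = a - 2" "l2 = 0" by linarith+
      have "x3 = w3 + lat 1 0 (-1)" using 3(7) k2 a_ge by (simp add: of_nat_diff)
      then have x3: "x3 = w3 + c" by (simp add: lat_c)
      have i: "odd (2 * k - 1)" "Suc ((2 * k - 1) div 2) = k" using l by presburger+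
      have "x = place (2 * k - 1) w3"
        unfolding place_odd_digits(1)[OF i(1)] i(2) 1(3) 2(3) 3(3) k1 k2 x3 ..
      moreover have "2 * k - 1 < n"
        using s 1(1) k1_Maxed[OF k1] l a_ge by (auto simp: allowed_def nxt_def split: if_splits)
      moreover have "w3 \<in> K Zeros" "w3 + c \<in> K Zeros" using 3(2,5) x3 K_subset by auto
      ultimately show ?thesis using i(1) by blast
    next
      case p: 2
      have x2c: "x2 = w2 + lat 1 1 (-1)" using x2 p by simp
      \<comment> \<open>After the digit a - 1 in this place the state is \<open>Maxed\<close>, so
        the next digit is at most a - 2 and the first coefficient a + l2 - k2 would be at least
        2.\<close>
      have "k1 \<noteq> a - 1"
      proof
        assume "k1 = a - 1"
        then have "x2 \<in> K Maxed" using k1_Maxed by simp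
        then obtain k2 x3 l2 w3 where 3: "allowed a Maxed k2"
          "x3 \<in> K (nxt a Maxed k2)" "x2 = of_nat k2 + \<alpha> * x3"
          "allowed a (nxt a (nxt a s2 l) l1) l2" "w3 \<in> K (nxt a (nxt a (nxt a s2 l) l1) l2)"
          "w2 = of_nat l2 + \<alpha> * w3" "x3 = w3 + lat (1 + 1 * int a + -1 + int l2 - int k2) (- 1) (- 1)"
          using 2(5) x2c by (rule lat_step)
        have "\<bar>1 + 1 * int a + -1 + int l2 - int k2\<bar> \<le> 1"
          by (rule lat_v_le[OF 3(2,5,7)]) simp
        moreover have "k2 < a - 1" using 3(1) by (auto simp: allowed_def)
        ultimately show False by linarith
      qed
      then have k1: "k1 = a - 2" using p 2(1) a_ge by (auto simp: p_def allowed_def)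
      have "x2 = rgt + c" using corner_plus[OF 2(2,5) x2c] .
      then have "x = place (2 * k - 1) rgt"
        using l by (subst place_odd_rgt) (simp_all add: 1(3) 2(3) k1 del: of_nat_Suc)
      moreover have "k < a" using 1(1) by (simp add: allowed_def)
      then have "real (2 * k - 1) \<in> {0..real n}" "real (2 * k - 1) \<in> {0..len}"
        using s by (auto simp: len_def)
      moreover have "curve (real (2 * k - 1)) = place (2 * k - 1) rgt"
        using curve_eq[OF \<open>real (2 * k - 1) \<in> {0..len}\<close>, of "2 * k - 1"] l
        by (simp add: stretch_def curve_ends)
      ultimately show ?thesis by (metis imageI)
    qed
  qed
qed

lemma stretch_invert:
  assumes "u \<in> {0..stretch i}" "real i + 1 \<le> len"
  obtains t where "t \<in> {0..real i + 1}" "curve t = place i (curve u)"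
proof
  define t where "t = real i + 1 - u / stretch i"
  have st: "0 < stretch i" using stretch_bounds(1)[of i] by simp
  have "0 \<le> u / stretch i" "u / stretch i \<le> 1" using assms st by auto
  then have t: "real i \<le> t" "t \<le> real i + 1" by (auto simp: t_def)
  then show "t \<in> {0..real i + 1}" by auto
  have "t \<in> {0..len}" using t assms(2) by auto
  then have "curve t = place i (curve (stretch i * (real i + 1 - t)))" using t by (rule curve_eq)
  also have "stretch i * (real i + 1 - t) = u" using st by (simp add: t_def)
  finally show "curve t = place i (curve u)" .
qed

text \<open>Each \<open>overlap_step\<close> reaches the curve or passes to an overlap point one
  contraction deeper, so x is within \<open>r ^ m * C\<close> of the closed curve for all m. The
  smaller overlap is carried along because the even pieces refer to it.\<close>

lemma overlap_curve:
  "x \<in> K Zeros \<Longrightarrow> x + c \<in> K Zeros \<Longrightarrow> x \<in> curve ` {0..len}"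
proof -
  obtain B where B: "\<And>s x. x \<in> K s \<Longrightarrow> norm x \<le> B" using K_bounded by blast
  define C where "C = B + norm lft"
  define r where "r = norm \<alpha> ^ 2"
  have r: "0 \<le> r" "r < 1" using norm_alpha by (auto simp: r_def power_less_one_iff)
  have C: "0 \<le> C" if "x \<in> K s" for x s 
    using B[OF that] norm_ge_zero[of x] norm_ge_zero[of lft] unfolding C_def by linarith
  have n: "real (2 * a - 1) = len" "real (2 * a - 3) = len - 2" using len_nat by auto
  have approx: "(\<forall>x. x \<in> K Zeros \<longrightarrow> x + c \<in> K Zeros \<longrightarrow> (\<exists>t\<in>{0..len}. norm (x - curve t) \<le> r ^ m * C)) \<and>
    (\<forall>x. x \<in> K Zero \<longrightarrow> x + c \<in> K Maxed \<longrightarrow> (\<exists>t\<in>{0..len - 2}. norm (x - curve t) \<le> r ^ m * C))" for m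
  proof (induction m)
    case 0
    have "norm (x - curve 0) \<le> C" if "x \<in> K s" for x s
      using norm_triangle_ineq4[of x lft] B[OF that] by (simp add: C_def curve_ends)
    then show ?case using len_ge by (intro conjI allI impI bexI[of _ 0]) auto
  next
    case (Suc m)
    have *: "\<exists>t\<in>{0..real n}. norm (x - curve t) \<le> r ^ Suc m * C"
      if s: "s1 = Zeros \<and> s2 = Zeros \<and> n = 2 * a - 1 \<or> s1 = Zero \<and> s2 = Maxed \<and> n = 2 * a - 3"
        and x: "x \<in> K s1" "x + c \<in> K s2" for x s1 s2 n
      using overlap_step[OF s x]
    proof (elim disjE exE conjE)
      assume "x \<in> curve ` {0..real n}"
      then obtain t where "t \<in> {0..real n}" "x = curve t" by auto
      then show ?thesis using r C[OF x(1)] by (intro bexI[of _ t]) auto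
    next
      fix i y assume y: "i < n" "x = place i y" "y \<in> K Zeros" "y + c \<in> K Zeros"
        "even i \<and> i \<noteq> 0 \<longrightarrow> y \<in> K Zero \<and> y + c \<in> K Maxed"
      have "\<exists>u\<in>{0..stretch i}. norm (y - curve u) \<le> r ^ m * C"
        using Suc.IH y(3-5) by (auto simp: stretch_def)
      then obtain u where u: "u \<in> {0..stretch i}" "norm (y - curve u) \<le> r ^ m * C" by blast
      have "real i + 1 \<le> real n" using y(1) by linarith
      moreover have "real n \<le> len" using s n by auto
      ultimately have "real i + 1 \<le> len" by linarith
      with u(1) obtain t where t: "t \<in> {0..real i + 1}" "curve t = place i (curve u)"
        by (rule stretch_invert)
      have "x - curve t = \<alpha> ^ (2 + i mod 2) * (y - curve u)"
        by (simp add: y(2) t(2) place_def algebra_simps)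
      then have "norm (x - curve t) = norm \<alpha> ^ (2 + i mod 2) * norm (y - curve u)"
        by (simp add: norm_mult norm_power)
      also have "\<dots> \<le> r * (r ^ m * C)"
      proof (intro mult_mono u(2))
        show "norm \<alpha> ^ (2 + i mod 2) \<le> r"
          unfolding r_def using norm_alpha by (intro power_decreasing) auto
      qed (use r in auto)
      finally show ?thesis using t(1) \<open>real i + 1 \<le> real n\<close> by (intro bexI[of _ t]) (auto simp: mult_ac)
    qed
    show ?case using *[of Zeros Zeros "2 * a - 1"] *[of Zero Maxed "2 * a - 3"] unfolding n by blast
  qed
  show "x \<in> curve ` {0..len}" if "x \<in> K Zeros" "x + c \<in> K Zeros"
  proof -
    have "closed (curve ` {0..len})"
      by (intro compact_imp_closed compact_continuous_image continuous_curve) simp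
    moreover have "x \<in> closure (curve ` {0..len})"
      unfolding closure_approachable
    proof (intro allI impI)
      fix \<epsilon> :: real assume "0 < \<epsilon>"
      have "(\<lambda>m. r ^ m * C) \<longlonglongrightarrow> 0" using r by (intro tendsto_mult_left_zero LIMSEQ_power_zero) auto
      then have "\<forall>\<^sub>F m in sequentially. r ^ m * C < \<epsilon>" using \<open>0 < \<epsilon>\<close> by (rule order_tendstoD)
      then obtain m where "r ^ m * C < \<epsilon>" by (auto simp: eventually_sequentially)
      moreover obtain t where "t \<in> {0..len}" "norm (x - curve t) \<le> r ^ m * C" using approx \<open>x \<in> K Zeros\<close> \<open>x + c \<in> K Zeros\<close> by blast
      ultimately show "\<exists>y\<in>curve ` {0..len}. dist y x < \<epsilon>"
        by (intro bexI[of _ "curve t"]) (auto simp: dist_norm norm_minus_commute)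
    qed
    ultimately show ?thesis by simp
  qed
qed

section \<open>Injectivity of the curve\<close>

text \<open>The last two claims prepend a digit: 0 to z, and a - 1 to z + c, the latter giving
  \<alpha> z + h.\<close>

lemma curve_tiles:
  assumes "u \<in> {0..len}"
  shows "curve u \<in> K Zeros" "curve u + c \<in> K Zeros" "\<alpha> * curve u \<in> K Zeros" "\<alpha> * curve u + h \<in> K Zeros"
proof -
  show 1: "curve u \<in> K Zeros" and "curve u + c \<in> K Zeros"
    using curve_in_K(1,2)[OF assms] K_subset by auto
  show "\<alpha> * curve u \<in> K Zeros"
    using K_Cons[of Zeros 0 "curve u"] 1 a_ge by (simp add: allowed_def nxt_def)
  have "of_nat (a - 1) + \<alpha> * (curve u + c) \<in> K Zeros"
    using curve_in_K(2)[OF assms] a_ge by (intro K_Cons) (simp_all add: allowed_def nxt_def)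
  also have "of_nat (a - 1) + \<alpha> * (curve u + c) = \<alpha> * curve u + h"
    unfolding of_nat_digit distrib_left alpha_c by (simp add: h_def)
  finally show "\<alpha> * curve u + h \<in> K Zeros" .
qed

text \<open>A lattice shift turns a meeting of adjacent sides into two tile points differing by a
  diagonal vector, which the corner lemmas locate. A meeting of opposite sides would give tile
  points differing by 2c or 2h, which is too far.\<close>

lemma curve_meets:
  assumes "u \<in> {0..len}" "w \<in> {0..len}"
  shows "curve u = \<alpha> * curve w \<Longrightarrow> curve u = lft"
    "\<alpha> * curve w = curve u + c \<Longrightarrow> curve u = lft"
    "curve u = \<alpha> * curve w + h \<Longrightarrow> curve u = rgt"
    "\<alpha> * curve w + h = curve u + c \<Longrightarrow> curve u = rgt"
    "curve u \<noteq> curve w + c" "\<alpha> * curve u \<noteq> \<alpha> * curve w + h"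
proof -
  note u = curve_tiles[OF assms(1)] and w = curve_tiles[OF assms(2)]
  show "curve u = lft" if "curve u = \<alpha> * curve w"
  proof -
    have "\<alpha> * curve w + h = (curve u + c) + lat (-1) 1 1" using that by (simp add: lat_def c_def)
    from corner_minus[OF w(4) u(2) this] show ?thesis using that by (simp add: rgt_eq)
  qed
  show "curve u = lft" if "\<alpha> * curve w = curve u + c"
  proof -
    have "\<alpha> * curve w + h = curve u + lat 1 1 (-1)" using that by (simp add: lat_def c_def)
    from corner_plus[OF w(4) u(1) this] show ?thesis using that by (simp add: rgt_eq)
  qed
  show "curve u = rgt" if "curve u = \<alpha> * curve w + h"
  proof -
    have "curve u + c = \<alpha> * curve w + lat 1 1 (-1)" using that by (simp add: lat_def c_def)
    from corner_plus[OF u(2) w(3) this] show ?thesis by simp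
  qed
  show "curve u = rgt" if "\<alpha> * curve w + h = curve u + c"
  proof -
    have "curve u = \<alpha> * curve w + h - c" using that by simp
    then have "curve u = \<alpha> * curve w + lat (-1) 1 1" by (simp add: lat_def c_def)
    from corner_minus[OF u(1) w(3) this] show ?thesis .
  qed
  show "curve u \<noteq> curve w + c"
  proof
    assume "curve u = curve w + c"
    then have "curve u + c = curve w + lat 2 0 (-2)" by (simp add: lat_def c_def)
    from lat_v_le[OF u(2) w(1) this] show False by simp
  qed
  show "\<alpha> * curve u \<noteq> \<alpha> * curve w + h"
  proof
    assume "\<alpha> * curve u = \<alpha> * curve w + h"
    then have "\<alpha> * curve u + h = \<alpha> * curve w + lat 0 2 0" by (simp add: lat_def)
    from lat_Dif(2)[OF u(4) w(3) this] have "real a < 1 - 1 / \<beta>" by simp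
    moreover have "0 \<le> 1 / \<beta>" using beta_gt1 by simp
    ultimately show False using a_ge by linarith
  qed
qed

lemma lat_far_False:
  assumes "x \<in> K s1" "y \<in> K s2" "x = y + lat p q r" "2 * \<beta> - 1 \<le> \<bar>\<beta> * p + q\<bar>"
  shows False
  using lat_Dif(1)[OF assms(1-3)] assms(4) by simp

text \<open>The size is \<beta> + (\<beta> - 1) m, which already reaches the forbidden value 2
  \<beta> - 1 at m = 1.\<close>

lemma lat_diag_False:
  assumes "x \<in> K s1" "y \<in> K s2" "x = y + lat (int m + 1) (- int m) r" "1 \<le> m"
  shows False
proof (rule lat_far_False[OF assms(1-3)])
  have "(\<beta> - 1) * 1 \<le> (\<beta> - 1) * real m" using assms(4) beta_gt1 by (intro mult_left_mono) auto
  then show "2 * \<beta> - 1 \<le> \<bar>\<beta> * real_of_int (int m + 1) + real_of_int (- int m)\<bar>"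
    by (simp add: algebra_simps)
qed

lemma v_cube: "v * (v * v) = lat (1 - int a) (-1) 1"
  unfolding v_mult_v right_diff_distrib v_mult_h by (simp add: lat_def algebra_simps)

text \<open>Dividing by the common power of \<alpha> leaves a difference that is \<open>m\<close>
  times \<open>v * v\<close> or \<open>v * (v * v)\<close>. Size excludes every pair of pieces
  except consecutive ones, and for these \<open>curve_meets\<close> identifies the point.\<close>

lemma pieces_meet:
  assumes "i < j" and u: "u \<in> {0..len}" and w: "w \<in> {0..len}"
    and w': "even j \<and> j \<noteq> 0 \<longrightarrow> w \<in> {0..len - 2}"
    and eq: "place i (curve u) = place j (curve w)"
  shows "j = Suc i \<and> curve u = lft"
proof -
  define U where "U = curve u"
  define W where "W = curve w"
  define m where "m = j div 2 - i div 2"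
  note uK = curve_tiles[OF u, folded U_def] and wK = curve_tiles[OF w, folded W_def]
  have "i div 2 \<le> j div 2" using assms(1) by (intro div_le_mono) auto
  then have m: "of_nat (j div 2) = of_nat (i div 2) + (of_nat m :: complex)"
    by (simp add: m_def flip: of_nat_add)
  have eq': "\<alpha> ^ (2 + i mod 2) * U = of_nat m + \<alpha> ^ (2 + j mod 2) * W"
    using eq m by (simp add: place_def U_def W_def algebra_simps)
  consider "even i" "even j" | "odd i" "odd j" | "even i" "odd j" | "odd i" "even j" by blast
  then show ?thesis
  proof cases
    case 1
    then have "\<alpha> * (\<alpha> * U) = of_nat m + \<alpha> * (\<alpha> * W)" using eq' by (simp add: power2_eq_square mult.assoc)
    then have "U = W + of_nat m * (v * v)" using alpha_v(1) by algebra
    then have "U + c = W + lat (int m + 1) (- int m) (-1)"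
      unfolding v_mult_v by (simp add: lat_def c_def algebra_simps)
    moreover have "1 \<le> m" using assms(1) 1 by (auto simp: m_def elim!: evenE)
    ultimately show ?thesis using lat_diag_False[OF uK(2) wK(1)] by blast
  next
    case 2
    then have "i mod 2 = 1" "j mod 2 = 1" by presburger+
    then have "\<alpha> * (\<alpha> * (\<alpha> * U)) = of_nat m + \<alpha> * (\<alpha> * (\<alpha> * W))"
      using eq' by (simp add: power3_eq_cube mult.assoc)
    then have "U = W + of_nat m * (v * (v * v))" using alpha_v(1) by algebra
    then have *: "U = W + lat (int m * (1 - int a)) (- int m) (int m)"
      unfolding v_cube by (simp add: lat_def algebra_simps)
    have "1 \<le> m" using assms(1) 2 by (auto simp: m_def elim!: oddE)
    have False
    proof (rule lat_far_False[OF uK(1) wK(1) *])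
      have "2 * \<beta> \<le> (real a - 1) * \<beta>" using a_ge beta_gt1 by (intro mult_right_mono) auto
      then have "2 * \<beta> - 1 \<le> 1 * ((real a - 1) * \<beta> + 1)" by simp
      also have "\<dots> \<le> real m * ((real a - 1) * \<beta> + 1)"
        using \<open>1 \<le> m\<close> a_ge beta_gt1 by (intro mult_right_mono) auto
      also have "\<dots> = - (\<beta> * real_of_int (int m * (1 - int a)) + real_of_int (- int m))"
        by (simp add: algebra_simps)
      finally show "2 * \<beta> - 1 \<le> \<bar>\<beta> * real_of_int (int m * (1 - int a)) + real_of_int (- int m)\<bar>"
        by linarith
    qed
    then show ?thesis ..
  next
    case 3
    then have "i mod 2 = 0" "j mod 2 = 1" by presburger+
    then have "\<alpha> * (\<alpha> * U) = of_nat m + \<alpha> * (\<alpha> * (\<alpha> * W))"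
      using eq' by (simp add: power3_eq_cube power2_eq_square mult.assoc)
    then have *: "U = \<alpha> * W + of_nat m * (v * v)" using alpha_v(1) by algebra
    then have "U + c = \<alpha> * W + lat (int m + 1) (- int m) (-1)"
      unfolding v_mult_v by (simp add: lat_def c_def algebra_simps)
    from lat_diag_False[OF uK(2) wK(3) this] have "m = 0" by (cases m) auto
    then have "U = \<alpha> * W" using * by simp
    moreover have "j = Suc i" using \<open>m = 0\<close> assms(1) 3 \<open>i div 2 \<le> j div 2\<close>
      by (auto simp: m_def elim!: oddE evenE)
    ultimately show ?thesis using curve_meets(1)[OF u w] by (simp add: U_def W_def)
  next
    case 4
    then have ij: "i mod 2 = 1" "j mod 2 = 0" by presburger+
    then have "\<alpha> * (\<alpha> * (\<alpha> * U)) = of_nat m + \<alpha> * (\<alpha> * W)"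
      using eq' by (simp add: power3_eq_cube power2_eq_square mult.assoc)
    then have *: "\<alpha> * U = W + of_nat m * (v * v)" using alpha_v(1) by algebra
    have m1: "1 \<le> m" using assms(1) 4 by (auto simp: m_def elim!: oddE evenE)
    have "m = 1"
    proof (rule ccontr)
      assume "m \<noteq> 1"
      then obtain m' where m': "m = Suc m'" "1 \<le> m'" using m1 by (cases m) auto
      have "\<alpha> * U + h = W + lat (int m' + 1) (- int m') 0"
        unfolding * v_mult_v m' by (simp add: lat_def algebra_simps)
      then show False using lat_diag_False[OF uK(4) wK(1)] m'(2) by blast
    qed
    then have j: "j = Suc i" using 4 assms(1) by (auto simp: m_def elim!: oddE evenE)
    \<comment> \<open>The difference \<open>v\<close> is not in the lattice, so the neighbour facts
      do not apply. As \<open>w'\<close> places w in \<open>{0..len - 2}\<close>, W lies in some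
      piece l < 2a - 3; expanding it gives the difference \<open>lat (n + 1) 0 (-1)\<close>, which
      leaves only l = 2a - 4.\<close>
    have "\<alpha> * U + h = W + v" using * \<open>m = 1\<close> by (simp add: v_mult_v)
    then have Wc: "W + c = \<alpha> * U + h - 1" by (simp add: c_def)
    have "w \<in> {0..real (2 * a - 3)}" "0 < 2 * a - 3" "real (2 * a - 3) \<le> len"
      using w' 4 j a_ge len_nat by auto
    then obtain l z where l: "l < 2 * a - 3" "real l \<le> w" "w \<le> real l + 1"
      "z = stretch l * (real l + 1 - w)" "curve w = place l (curve z)" "z \<in> {0..len}"
      "even l \<and> l \<noteq> 0 \<longrightarrow> z \<in> {0..len - 2}" by (rule curve_piece)
    define V where "V = curve z"
    note zK = curve_tiles[OF l(6), folded V_def]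
    define n where "n = a - 2 - l div 2"
    have "l div 2 \<le> a - 2" using l(1) by linarith
    then have n: "of_nat (l div 2) = of_nat a - 2 - (of_nat n :: complex)"
      using a_ge by (simp add: n_def of_nat_diff)
    have "W + c = of_nat (l div 2) + \<alpha> * (\<alpha> * \<alpha> ^ (l mod 2) * V)"
      by (simp add: W_def l(5) place_def V_def power_add power2_eq_square mult.assoc)
    moreover define G where "G = \<alpha> * \<alpha> ^ (l mod 2) * V"
    ultimately have "\<alpha> * G = \<alpha> * U + of_nat n + 1 - \<alpha>"
      unfolding Wc n by (simp add: h_def algebra_simps)
    then have "G = U + (of_nat n + 1) * v - 1" using alpha_v(1) by algebra
    then have "\<alpha> * \<alpha> ^ (l mod 2) * V = U + (of_nat n + 1) * v - 1" by (simp only: G_def)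
    then have **: "\<alpha> * \<alpha> ^ (l mod 2) * V = U + lat (int n + 1) 0 (-1)" by (simp add: lat_def)
    have VK: "\<alpha> * \<alpha> ^ (l mod 2) * V \<in> K Zeros"
    proof (cases "even l")
      case True
      then show ?thesis using zK(3) by simp
    next
      case False
      have "of_nat 0 + \<alpha> * (\<alpha> * V) \<in> K Zeros"
        using zK(3) a_ge by (intro K_Cons) (auto simp: allowed_def nxt_def)
      then show ?thesis using False by (simp add: odd_iff_mod_2_eq_one mult.assoc)
    qed
    have "n = 0"
      using lat_v_le[OF VK uK(1) **] by simp
    have "even l"
    proof (rule ccontr)
      assume "odd l"
      then obtain k where "l = 2 * k + 1" by (rule oddE)
      with l(1) \<open>n = 0\<close> show False by (simp add: n_def)
    qed
    then have "\<alpha> * V = U + c" using ** \<open>n = 0\<close> lat_c[of U] by simp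
    then show ?thesis using curve_meets(2)[OF u l(6)] j by (simp add: U_def V_def)
  qed
qed

text \<open>Equal values force |x - y| \<le> len (2/3)^n for every n. Inside one piece the parameter
  distance expands by at least 3, so the bound improves to a third; for adjacent pieces the common
  end b splits the distance into two such thirds.\<close>

lemma curve_inj: "inj_on curve {0..len}"
proof (rule inj_onI)
  fix x y assume xy: "x \<in> {0..len}" "y \<in> {0..len}" "curve x = curve y"
  have same: "\<bar>x - y\<bar> \<le> D / 3"
    if D: "\<And>x y. x \<in> {0..len} \<Longrightarrow> y \<in> {0..len} \<Longrightarrow> curve x = curve y \<Longrightarrow> \<bar>x - y\<bar> \<le> D"
      and x: "x \<in> {0..len}" "real i \<le> x" "x \<le> real i + 1"
      and y: "y \<in> {0..len}" "real i \<le> y" "y \<le> real i + 1" and eq: "curve x = curve y" for x y i D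
  proof -
    let ?x = "stretch i * (real i + 1 - x)" and ?y = "stretch i * (real i + 1 - y)"
    have "place i (curve ?x) = place i (curve ?y)"
      using curve_eq[OF x] curve_eq[OF y] eq by simp
    then have "curve ?x = curve ?y" by (simp add: place_def)
    then have "\<bar>?x - ?y\<bar> \<le> D" by (intro D stretch_arg x y)
    moreover have "?x - ?y = stretch i * (y - x)" by (simp add: algebra_simps)
    ultimately have "stretch i * \<bar>x - y\<bar> \<le> D"
      using stretch_bounds(1)[of i] by (simp add: abs_mult abs_minus_commute)
    moreover have "3 * \<bar>x - y\<bar> \<le> stretch i * \<bar>x - y\<bar>"
      using stretch_bounds(1)[of i] by (intro mult_right_mono) auto
    ultimately show ?thesis by simp
  qed
  have "\<bar>x - y\<bar> \<le> len * (2 / 3) ^ n" if "x \<in> {0..len}" "y \<in> {0..len}" "curve x = curve y" for n x y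
    using that
  proof (induction n arbitrary: x y)
    case 0
    then show ?case by (auto simp: abs_if)
  next
    case (Suc n)
    have main: "\<bar>x - y\<bar> \<le> len * (2 / 3) ^ Suc n"
      if x: "x \<in> {0..len}" "real i \<le> x" "x \<le> real i + 1"
        and y: "y \<in> {0..len}" "real j \<le> y" "y \<le> real j + 1" and eq: "curve x = curve y"
        and "i \<le> j" for x y i j
    proof (cases "i = j")
      case True
      then have "\<bar>x - y\<bar> \<le> len * (2 / 3) ^ n / 3" using same[OF Suc.IH x y(1) _ _ eq] y by blast
      moreover have "0 \<le> len * (2 / 3) ^ n" using len_ge by simp
      ultimately show ?thesis by simp
    next
      case False
      define u where "u = stretch i * (real i + 1 - x)"
      define w where "w = stretch j * (real j + 1 - y)"
      have "j = Suc i \<and> curve u = lft"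
      proof (rule pieces_meet)
        show "i < j" using False \<open>i \<le> j\<close> by simp
        show "u \<in> {0..len}" "w \<in> {0..len}" "even j \<and> j \<noteq> 0 \<longrightarrow> w \<in> {0..len - 2}"
          unfolding u_def w_def using stretch_arg[OF x(2,3)] stretch_arg[OF y(2,3)] by blast+
        show "place i (curve u) = place j (curve w)"
          using curve_eq[OF x] curve_eq[OF y] eq by (simp add: u_def w_def)
      qed
      then have j: "j = Suc i" and "curve u = lft" by auto
      define b where "b = real i + 1"
      have b: "b \<in> {0..len}" "real i \<le> b" "b \<le> real i + 1" "real j \<le> b" "b \<le> real j + 1"
        using x(1,2) y(1,2) by (auto simp: b_def j)
      have "curve x = place i lft"
        using curve_eq[OF x] \<open>curve u = lft\<close> by (simp add: u_def)
      moreover have "curve b = place i lft" using curve_eq[OF b(1-3)] by (simp add: b_def curve_ends)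
      ultimately have cb: "curve x = curve b" "curve b = curve y" using eq by simp_all
      have "\<bar>x - b\<bar> \<le> len * (2 / 3) ^ n / 3" by (rule same[OF Suc.IH x b(1-3) cb(1)])
      moreover have "\<bar>b - y\<bar> \<le> len * (2 / 3) ^ n / 3" by (rule same[OF Suc.IH b(1,4,5) y cb(2)])
      moreover have "len * (2 / 3) ^ Suc n = len * (2 / 3) ^ n / 3 + len * (2 / 3) ^ n / 3" by simp
      ultimately show ?thesis using abs_triangle_ineq[of "x - b" "b - y"] by linarith
    qed
    have "0 < 2 * a - 1" using a_ge by simp
    have bds: "0 \<le> x" "x \<le> real (2 * a - 1)" "0 \<le> y" "y \<le> real (2 * a - 1)"
      using Suc.prems(1,2) len_nat(1) by auto
    obtain i where i: "i < 2 * a - 1" "real i \<le> x" "x \<le> real i + 1"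
      using bds(1,2) \<open>0 < 2 * a - 1\<close> by (rule unit_interval_cover)
    obtain j where j: "j < 2 * a - 1" "real j \<le> y" "y \<le> real j + 1"
      using bds(3,4) \<open>0 < 2 * a - 1\<close> by (rule unit_interval_cover)
    show ?case
    proof (cases "i \<le> j")
      case True
      then show ?thesis using main[OF Suc.prems(1) i(2,3) Suc.prems(2) j(2,3) Suc.prems(3)] by simp
    next
      case False
      then have "\<bar>y - x\<bar> \<le> len * (2 / 3) ^ Suc n"
        using main[OF Suc.prems(2) j(2,3) Suc.prems(1) i(2,3) Suc.prems(3)[symmetric]] by simp
      then show ?thesis by (simp add: abs_minus_commute)
    qed
  qed
  from this[OF xy] have bound: "\<bar>x - y\<bar> \<le> len * (2 / 3) ^ n" for n .
  have "(\<lambda>n. len * (2 / 3) ^ n) \<longlonglongrightarrow> 0"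
    by (intro tendsto_mult_right_zero LIMSEQ_power_zero) simp
  then have "\<bar>x - y\<bar> \<le> 0" by (rule LIMSEQ_le_const) (use bound in auto)
  then show "x = y" by simp
qed

end

section \<open>The lattice tiling\<close>

context rauzy
begin

abbreviation tau :: "int \<Rightarrow> int \<Rightarrow> complex" where
  "tau m n \<equiv> lat m n (- m)"

lemma tau_eq: "tau m n = of_int m * c + of_int n * h"
  by (simp add: lat_def c_def algebra_simps)

definition boundary :: "complex set" where
  "boundary = curve ` {0..len} \<union> (\<lambda>z. z + c) ` curve ` {0..len} \<union>
     (\<lambda>z. \<alpha> * z) ` curve ` {0..len} \<union> (\<lambda>z. \<alpha> * z + h) ` curve ` {0..len}"

text \<open>The \<open>Yc\<close> bound gives |m| < 2 + (|n| - 1)/\<beta>, and the \<open>Xc\<close>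
  bound controls a |n| through |m|/\<beta>. With 1/\<beta> \<le> 4/11 these are incompatible for |n|
  \<ge> 2.\<close>

lemma neighbours:
  assumes "x \<in> K s1" "y \<in> K s2" "x = y + tau m n"
  shows "\<bar>m\<bar> \<le> 1" "\<bar>n\<bar> \<le> 1"
proof -
  define b where "b = 1 / \<beta>"
  define M where "M = \<bar>real_of_int m\<bar>"
  define L where "L = \<bar>real_of_int n\<bar>"
  have b: "0 < b" "b \<le> 4 / 11" "\<beta> * b = 1" using beta_ge by (auto simp: b_def field_simps)
  have Y: "\<bar>\<beta> * m + n\<bar> < 2 * \<beta> - 1" and X: "\<bar>real a * n - b * m\<bar> < real a + 1 - b"
    using lat_Dif[OF assms] by (simp_all add: b_def algebra_simps)
  show n1: "\<bar>n\<bar> \<le> 1"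
  proof (rule ccontr)
    assume "\<not> \<bar>n\<bar> \<le> 1"
    then have L: "2 \<le> L" by (simp add: L_def)
    have "\<bar>\<beta> * m\<bar> = \<beta> * M" "\<bar>b * m\<bar> = b * M" "\<bar>real a * n\<bar> = real a * L"
      using b beta_gt1 by (auto simp: M_def L_def abs_mult)
    with X Y have 1: "\<beta> * M < 2 * \<beta> - 1 + L" and 2: "real a * L < real a + 1 - b + b * M"
      by (auto simp: L_def)
    have "b * (\<beta> * M) < b * (2 * \<beta> - 1 + L)" using 1 b(1) by (rule mult_strict_left_mono)
    then have "(\<beta> * b) * M < 2 * (\<beta> * b) + b * (L - 1)" by (simp add: algebra_simps)
    then have "M < 2 + b * (L - 1)" by (simp add: b(3))
    moreover have "b * (L - 1) \<le> 4 / 11 * (L - 1)" using b L by (intro mult_right_mono) auto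
    ultimately have "M < 18 / 11 + 4 / 11 * L" by argo
    moreover have "b * M \<le> 4 / 11 * M" using b by (intro mult_right_mono) (auto simp: M_def)
    ultimately have "b * M < 72 / 121 + 16 / 121 * L" by argo
    moreover have "3 * (L - 1) \<le> real a * (L - 1)" using a_ge L by (intro mult_right_mono) auto
    then have "3 * (L - 1) \<le> real a * L - real a" by (simp add: algebra_simps)
    ultimately show False using 2 b(1) L by argo
  qed
  show "\<bar>m\<bar> \<le> 1" by (rule lat_v_le[OF assms n1])
qed

text \<open>For a difference h the first digits are forced to be a - 1 and 0 and the tails differ by
  c, so the vertical overlap is \<alpha> times the horizontal one. Diagonal overlaps are
  corners.\<close>

lemma overlap_boundary:
  assumes x: "x \<in> K Zeros" and y: "y \<in> K Zeros" and eq: "x = y + tau m n" and ne: "tau m n \<noteq> 0"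
  shows "x \<in> boundary"
proof -
  have ends: "lft \<in> curve ` {0..len}" "rgt \<in> curve ` {0..len}"
    using curve_ends(1,2) len_ge by (force intro: image_eqI[of _ _ 0] image_eqI[of _ _ len])+
  have horiz: "z \<in> curve ` {0..len} \<and> w \<in> (\<lambda>z. z + c) ` curve ` {0..len}"
    if "z \<in> K Zeros" "w \<in> K Zeros" "w = z + c" for z w
    using overlap_curve[of z] that by auto
  have vert: "w \<in> (\<lambda>z. \<alpha> * z) ` curve ` {0..len} \<and> z \<in> (\<lambda>z. \<alpha> * z + h) ` curve ` {0..len}"
    if zw: "z \<in> K Zeros" "w \<in> K Zeros" "z = w + h" for z w
  proof -
    have "z = w + lat 0 1 0" using zw(3) by (simp add: lat_def)
    from lat_step_up[OF zw(1,2) this] obtain x' y' where *: "x' \<in> K (nxt a Zeros (a - 1))"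
      "y' \<in> K (nxt a Zeros 0)" "z = of_nat (a - 1) + \<alpha> * x'" "w = \<alpha> * y'" "x' = y' + lat 1 (- 0) (- 1)"
      by auto
    then have "y' \<in> K Zeros" "y' + c \<in> K Zeros" using lat_c[of y'] K_subset by auto
    then have "y' \<in> curve ` {0..len}" by (rule overlap_curve)
    then show ?thesis using *(4) zw(3) by auto
  qed
  have eq': "x = y + (of_int m * c + of_int n * h)" using eq by (simp only: tau_eq)
  have "m \<in> {-1, 0, 1}" "n \<in> {-1, 0, 1}" using neighbours[OF x y eq] by auto
  moreover have "m \<noteq> 0 \<or> n \<noteq> 0" using ne by (auto simp: lat_def)
  ultimately consider "m = 1" "n = 0" | "m = -1" "n = 0" | "m = 0" "n = 1" | "m = 0" "n = -1"
    | "m = 1" "n = 1" | "m = -1" "n = -1" | "m = -1" "n = 1" | "m = 1" "n = -1" by blast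
  then show ?thesis
  proof cases
    case 1
    then show ?thesis using horiz[OF y x] eq' by (simp add: boundary_def)
  next
    case 2
    then show ?thesis using horiz[OF x y] eq' by (simp add: boundary_def)
  next
    case 3
    then show ?thesis using vert[OF x y] eq' by (simp add: boundary_def)
  next
    case 4
    then show ?thesis using vert[OF y x] eq' by (simp add: boundary_def)
  next
    case 5
    then have "x = rgt + c" using corner_plus[OF x y] eq by simp
    then show ?thesis using ends by (auto simp: boundary_def)
  next
    case 6
    then have "y = x + lat 1 1 (-1)" using eq by (simp add: lat_def)
    then have "y = rgt + c" by (rule corner_plus[OF y x])
    then have "x = lft" using eq' 6 by (simp add: rgt_eq)
    then show ?thesis using ends by (auto simp: boundary_def)
  next
    case 7
    then have "x = rgt" using corner_minus[OF x y] eq by simp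
    then show ?thesis using ends by (auto simp: boundary_def)
  next
    case 8
    then have "y = x + lat (-1) 1 1" using eq by (simp add: lat_def)
    then have "y = rgt" by (rule corner_minus[OF y x])
    then have "x = lft + c" using eq' 8 by (simp add: rgt_eq)
    then show ?thesis using ends by (auto simp: boundary_def)
  qed
qed

definition Lat :: "complex set" where
  "Lat = {tau m n | m n. True}"

lemma Lat_closed:
  "0 \<in> Lat" "c \<in> Lat" "h \<in> Lat" "x \<in> Lat \<Longrightarrow> y \<in> Lat \<Longrightarrow> x + y \<in> Lat"
  "x \<in> Lat \<Longrightarrow> of_int k * x \<in> Lat"
proof -
  show "0 \<in> Lat" unfolding Lat_def by (rule CollectI, rule exI[of _ 0], rule exI[of _ 0]) (simp add: lat_def c_def)
  show "c \<in> Lat" unfolding Lat_def by (rule CollectI, rule exI[of _ 1], rule exI[of _ 0]) (simp add: lat_def c_def)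
  show "h \<in> Lat" unfolding Lat_def by (rule CollectI, rule exI[of _ 0], rule exI[of _ 1]) (simp add: lat_def c_def)
  show "x + y \<in> Lat" if "x \<in> Lat" "y \<in> Lat"
  proof -
    obtain m n m' n' where "x = tau m n" "y = tau m' n'" using \<open>x \<in> Lat\<close> \<open>y \<in> Lat\<close> by (auto simp: Lat_def)
    then have "x + y = tau (m + m') (n + n')"
      by (simp only: tau_eq) (simp add: algebra_simps)
    then show ?thesis unfolding Lat_def by blast
  qed
  show "of_int k * x \<in> Lat" if "x \<in> Lat"
  proof -
    obtain m n where "x = tau m n" using \<open>x \<in> Lat\<close> by (auto simp: Lat_def)
    then have "of_int k * x = tau (k * m) (k * n)"
      by (simp only: tau_eq) (simp add: algebra_simps)
    then show ?thesis unfolding Lat_def by blast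
  qed
qed

text \<open>Bounded real coordinates bound both lattice coefficients, because the coordinate
  equations can be solved for them.\<close>

lemma Lat_locally_finite:
  assumes "bounded S"
  shows "finite {l \<in> Lat. \<exists>x\<in>K Zeros. x + l \<in> S}"
proof -
  obtain B where B: "\<And>s x. x \<in> K s \<Longrightarrow> norm x \<le> B" using K_bounded by blast
  obtain D where D: "\<And>z. z \<in> S \<Longrightarrow> norm z \<le> D" using assms by (auto simp: bounded_iff)
  define R where "R = B + D"
  define Q where "Q = R / \<bar>Im \<alpha>\<bar>"
  define Q' where "Q' = R + Q * \<bar>Re \<alpha>\<bar>"
  define T where "T = \<lceil>Q + Q'\<rceil>"
  have "{l \<in> Lat. \<exists>x\<in>K Zeros. x + l \<in> S} \<subseteq> case_prod tau ` ({-3 * T..3 * T} \<times> {-3 * T..3 * T})"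
  proof
    fix l assume "l \<in> {l \<in> Lat. \<exists>x\<in>K Zeros. x + l \<in> S}"
    then obtain m n x where l: "l = tau m n" "x \<in> K Zeros" "x + l \<in> S" by (auto simp: Lat_def)
    have "norm l \<le> R"
      using norm_triangle_ineq4[of "x + l" x] B[OF l(2)] D[OF l(3)] by (simp add: R_def)
    then have "\<bar>Im l\<bar> \<le> R" "\<bar>Re l\<bar> \<le> R"
      using abs_Im_le_cmod[of l] abs_Re_le_cmod[of l] by linarith+
    then have Y: "\<bar>Yc l\<bar> \<le> Q" by (simp add: Yc_def Q_def divide_right_mono)
    then have "\<bar>Yc l * Re \<alpha>\<bar> \<le> Q * \<bar>Re \<alpha>\<bar>" by (simp add: abs_mult mult_right_mono)
    then have X: "\<bar>Xc l\<bar> \<le> Q'" using \<open>\<bar>Re l\<bar> \<le> R\<close> unfolding Xc_def Q'_def by linarith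
    define b where "b = 1 / \<beta>"
    have b: "0 < b" "b \<le> 1" "\<beta> * b = 1" using beta_ge by (auto simp: b_def field_simps)
    have b2: "b * b \<le> 1 * 1" using b by (intro mult_mono) auto
    have Xl: "Xc l = real a * n - b * m" and Yl: "Yc l = - (\<beta> * m + n)"
      by (simp_all add: l(1) coord_lat b_def algebra_simps)
    \<comment> \<open>This combination of the two coordinates eliminates m.\<close>
    have "(real a + b * b) * n = Xc l - b * b * Yc l"
    proof -
      have "b * b * Yc l = - ((\<beta> * b) * (b * m) + b * b * n)" unfolding Yl by (simp add: algebra_simps)
      then show ?thesis unfolding Xl b(3) by (simp add: algebra_simps)
    qed
    moreover have "\<bar>b * b * Yc l\<bar> \<le> 1 * Q"
      using b2 Y unfolding abs_mult by (intro mult_mono) auto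
    ultimately have "\<bar>(real a + b * b) * n\<bar> \<le> Q + Q'" using X by linarith
    moreover have "1 * \<bar>real_of_int n\<bar> \<le> (real a + b * b) * \<bar>real_of_int n\<bar>"
      using a_ge b by (intro mult_right_mono) (auto intro: add_increasing2)
    ultimately have n: "\<bar>real_of_int n\<bar> \<le> Q + Q'" using a_ge b by (simp add: abs_mult)
    have "\<bar>\<beta> * m\<bar> \<le> Q + \<bar>real_of_int n\<bar>" using Y unfolding Yl by linarith
    moreover have "1 * \<bar>real_of_int m\<bar> \<le> \<beta> * \<bar>real_of_int m\<bar>"
      using beta_gt1 by (intro mult_right_mono) auto
    moreover have "0 \<le> Q'" "0 \<le> Q" using X Y by linarith+
    ultimately have m: "\<bar>real_of_int m\<bar> \<le> 2 * (Q + Q')" using n beta_gt1 by (simp add: abs_mult)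
    have "Q + Q' \<le> of_int T" "0 \<le> Q + Q'" using \<open>0 \<le> Q'\<close> \<open>0 \<le> Q\<close> by (auto simp: T_def)
    then have "real_of_int \<bar>m\<bar> \<le> real_of_int (3 * T)" "real_of_int \<bar>n\<bar> \<le> real_of_int (3 * T)"
      using m n by simp_all
    then have "\<bar>m\<bar> \<le> 3 * T" "\<bar>n\<bar> \<le> 3 * T" unfolding of_int_le_iff .
    then show "l \<in> case_prod tau ` ({-3 * T..3 * T} \<times> {-3 * T..3 * T})"
      using l(1) by (intro image_eqI[of _ _ "(m, n)"]) auto
  qed
  then show ?thesis by (rule finite_subset) auto
qed

text \<open>The numeration system: \<open>base n\<close> is the integer congruent to \<open>\<alpha>^n\<close> modulo the lattice, and
  greedy expansions in this base produce exactly the admissible digit strings.\<close>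

fun base :: "nat \<Rightarrow> int" where
  "base 0 = 1"
| "base (Suc 0) = int a"
| "base (Suc (Suc 0)) = int a * int a"
| "base (Suc (Suc (Suc n))) = int a * base (Suc (Suc n)) - base (Suc n) + base n"

text \<open>Doubling controls the negative term of the recurrence in the induction; the factor a
  keeps greedy digits below a.\<close>

lemma base_growth: "1 \<le> base n \<and> 2 * base n \<le> base (Suc n) \<and> base (Suc n) \<le> int a * base n"
proof (induction n rule: base.induct)
  case (4 n)
  have "3 * base (Suc (Suc n)) \<le> int a * base (Suc (Suc n))"
    using a_ge 4 by (intro mult_right_mono) auto
  moreover have "base (Suc (Suc (Suc (Suc n)))) = int a * base (Suc (Suc (Suc n))) - base (Suc (Suc n)) + base (Suc n)"
    by simp
  moreover have "3 * base (Suc (Suc (Suc n))) \<le> int a * base (Suc (Suc (Suc n)))"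
    using a_ge 4 by (intro mult_right_mono) auto
  ultimately show ?case using 4 by linarith
next
  case 3
  have "3 * (int a * int a) \<le> int a * (int a * int a)" "3 * int a \<le> int a * int a" "3 \<le> int a"
    using a_ge by (simp_all add: mult_right_mono)
  then show ?case unfolding base.simps by linarith
next
  case 2
  then show ?case using a_ge by auto
next
  case 1
  then show ?case using a_ge by auto
qed

lemma base_pos: "1 \<le> base n" and base_double: "2 * base n \<le> base (Suc n)" and base_le: "base (Suc n) \<le> int a * base n"
  using base_growth by auto

lemma base_ge: "int n \<le> base n"
proof (induction n)
  case (Suc n)
  then show ?case using base_double[of n] base_pos[of n] by simp
qed simp

text \<open>The coefficients spell the word (a-1)(a-1)01 of the admissibility condition, which links
  greedy expansions to it. The second equation is the boundary case with the last index
  missing.\<close>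

lemma base_parry:
  "base (Suc (Suc (Suc (Suc n)))) = (int a - 1) * base (Suc (Suc (Suc n))) + (int a - 1) * base (Suc (Suc n)) + base n"
  "base (Suc (Suc (Suc 0))) = (int a - 1) * base (Suc (Suc 0)) + (int a - 1) * base (Suc 0) + 1"
  by (simp_all add: algebra_simps)

lemma power_cong_base: "\<alpha> ^ n - of_int (base n) \<in> Lat"
proof (induction n rule: base.induct)
  case 1
  show ?case by (simp add: Lat_closed)
next
  case 2
  have "of_int (-1) * h \<in> Lat" by (intro Lat_closed)
  then show ?case by (simp add: h_def)
next
  case 3
  have "\<alpha>^2 - of_nat a * of_nat a = c + of_int (- int a) * h"
    by (simp add: c_def h_def v_eq algebra_simps)
  moreover have "c + of_int (- int a) * h \<in> Lat" by (intro Lat_closed)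
  ultimately show ?case by (simp add: power2_eq_square)
next
  case (4 n)
  have "\<alpha> ^ Suc (Suc (Suc n)) = \<alpha> ^ n * \<alpha> ^ 3" by (simp add: power3_eq_cube)
  also have "\<dots> = of_nat a * \<alpha> ^ Suc (Suc n) - \<alpha> ^ Suc n + \<alpha> ^ n"
    unfolding alpha_cubic by (simp add: algebra_simps power2_eq_square)
  finally have "\<alpha> ^ Suc (Suc (Suc n)) - of_int (base (Suc (Suc (Suc n)))) =
      of_int (int a) * (\<alpha> ^ Suc (Suc n) - of_int (base (Suc (Suc n)))) +
      (of_int (-1) * (\<alpha> ^ Suc n - of_int (base (Suc n))) + (\<alpha> ^ n - of_int (base n)))"
    by (simp add: algebra_simps)
  also have "\<dots> \<in> Lat" using 4 by (intro Lat_closed)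
  finally show ?case .
qed

end

section \<open>Admissible digit strings\<close>

text \<open>The condition selects j = n - 1 and j = n - 2. Indices below 0 count as zeros, matching
  the padding of the digit sequences.\<close>

definition two_zeros :: "(nat \<Rightarrow> nat) \<Rightarrow> nat \<Rightarrow> bool" where
  "two_zeros d n \<longleftrightarrow> (\<forall>j<n. n \<le> j + 2 \<longrightarrow> d j = 0)"

text \<open>The lexicographic condition made local: the word below (a-1)(a-1)01 may start with two
  digits a - 1 only if it ends in 00. The larger index is the more significant digit.\<close>

definition adm :: "nat \<Rightarrow> (nat \<Rightarrow> nat) \<Rightarrow> bool" where
  "adm a d \<longleftrightarrow> (\<forall>i. d i < a \<and> (d i = a - 1 \<and> d (Suc i) = a - 1 \<longrightarrow> two_zeros d i))"

lemma two_zeros_Suc: "two_zeros d (Suc n) \<longleftrightarrow> d n = 0 \<and> (n = 0 \<or> d (n - 1) = 0)"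
  unfolding two_zeros_def
proof (intro iffI conjI)
  assume *: "\<forall>j<Suc n. Suc n \<le> j + 2 \<longrightarrow> d j = 0"
  show "d n = 0" using *[rule_format, of n] by simp
  show "n = 0 \<or> d (n - 1) = 0" using *[rule_format, of "n - 1"] by (cases n) auto
next
  assume *: "d n = 0 \<and> (n = 0 \<or> d (n - 1) = 0)"
  show "\<forall>j<Suc n. Suc n \<le> j + 2 \<longrightarrow> d j = 0"
  proof (intro allI impI)
    fix j assume "j < Suc n" "Suc n \<le> j + 2"
    then have "j = n \<or> (j = n - 1 \<and> n \<noteq> 0)" by linarith
    then show "d j = 0" using * by auto
  qed
qed

text \<open>The middle equivalence serves the induction: \<open>Zeros\<close> is reached by a 0
  exactly from \<open>Zeros\<close> or \<open>Zero\<close>.\<close>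

lemma run_states:
  assumes "a \<ge> 3" "\<sigma> 0 = Zeros" "\<And>n. \<sigma> (Suc n) = nxt a (\<sigma> n) (d n)"
  shows "(\<sigma> n = Zeros \<longleftrightarrow> two_zeros d n) \<and> (\<sigma> n = Zeros \<or> \<sigma> n = Zero \<longleftrightarrow> n = 0 \<or> d (n - 1) = 0) \<and>
    (\<sigma> n = Maxed \<longleftrightarrow> n \<noteq> 0 \<and> d (n - 1) = a - 1 \<and> \<not> two_zeros d (n - 1))"
proof (induction n)
  case 0
  then show ?case using assms(2) by (simp add: two_zeros_def)
next
  case (Suc n)
  then show ?case using assms(1,3) by (auto simp: nxt_def two_zeros_Suc)
qed

lemma run_iff_adm:
  assumes "a \<ge> 3"
  shows "run a Zeros d \<longleftrightarrow> adm a d"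
proof
  assume "run a Zeros d"
  then obtain \<sigma> where \<sigma>: "\<sigma> 0 = Zeros" "\<And>n. allowed a (\<sigma> n) (d n)" "\<And>n. \<sigma> (Suc n) = nxt a (\<sigma> n) (d n)"
    unfolding run_def by blast
  note st = run_states[OF assms \<sigma>(1,3)]
  show "adm a d"
    unfolding adm_def
  proof (intro allI conjI impI)
    fix i
    show "d i < a" using \<sigma>(2) by (simp add: allowed_def)
    assume *: "d i = a - 1 \<and> d (Suc i) = a - 1"
    then have "\<sigma> (Suc i) \<noteq> Maxed" using \<sigma>(2)[of "Suc i"] by (auto simp: allowed_def)
    then show "two_zeros d i" using st[of "Suc i"] * by simp
  qed
next
  assume adm: "adm a d"
  define \<sigma> where "\<sigma> = rec_nat Zeros (\<lambda>n s. nxt a s (d n))"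
  have \<sigma>: "\<sigma> 0 = Zeros" "\<And>n. \<sigma> (Suc n) = nxt a (\<sigma> n) (d n)" by (simp_all add: \<sigma>_def)
  note st = run_states[OF assms \<sigma>]
  have "allowed a (\<sigma> n) (d n)" for n
    unfolding allowed_def
  proof (intro conjI impI notI)
    show "d n < a" using adm by (simp add: adm_def)
    assume "\<sigma> n = Maxed" "d n = a - 1"
    then obtain m where "n = Suc m" "d m = a - 1" "\<not> two_zeros d m"
      using st[of n] by (cases n) auto
    then show False using adm \<open>d n = a - 1\<close> unfolding adm_def by blast
  qed
  then show "run a Zeros d" unfolding run_def using \<sigma> by blast
qed

lemma rauzy_admissible_iff:
  assumes "a \<ge> 3" and low: "\<forall>i<2. D i = 0"
  shows "rauzy_admissible a D \<longleftrightarrow> adm a (\<lambda>n. D (int n + 2))"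
proof -
  define d where "d n = D (int n + 2)" for n
  have word: "([D i, D (i - 1), D (i - 2), D (i - 3)], [a - 1, a - 1, 0, 1]) \<in> lexord less_than \<longleftrightarrow>
      D i < a - 1 \<or> (D i = a - 1 \<and> (D (i - 1) < a - 1 \<or> (D (i - 1) = a - 1 \<and> D (i - 2) = 0 \<and> D (i - 3) = 0)))" for i
    by auto
  have tz: "two_zeros d n \<longleftrightarrow> D (int n + 1) = 0 \<and> D (int n) = 0" for n
  proof (cases n)
    case 0
    then show ?thesis using low by (simp add: two_zeros_def)
  next
    case (Suc k)
    have "k = 0 \<or> d (k - 1) = 0 \<longleftrightarrow> D (int k + 1) = 0"
      using low by (cases k) (auto simp: d_def add.commute)
    moreover have "d k = 0 \<longleftrightarrow> D (int n + 1) = 0" by (simp add: d_def Suc add.commute)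
    ultimately show ?thesis unfolding Suc two_zeros_Suc by (auto simp: add.commute)
  qed
  show ?thesis
  proof
    assume R: "rauzy_admissible a D"
    show "adm a (\<lambda>n. D (int n + 2))"
      unfolding adm_def d_def[symmetric]
    proof (intro allI conjI impI)
      fix n
      have "D (int n + 2) \<in> {0..a - 1}" using R by (simp add: rauzy_admissible_def)
      then show "d n < a" using assms(1) by (auto simp: d_def)
      assume *: "d n = a - 1 \<and> d (Suc n) = a - 1"
      have "([D (int n + 3), D (int n + 3 - 1), D (int n + 3 - 2), D (int n + 3 - 3)], [a - 1, a - 1, 0, 1])
          \<in> lexord less_than"
        using R unfolding rauzy_admissible_def by (elim conjE allE[of _ "int n + 3"]) simp_all
      from this[unfolded word] * show "two_zeros d n"
        unfolding tz by (auto simp: d_def algebra_simps)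
    qed
  next
    assume A: "adm a (\<lambda>n. D (int n + 2))"
    then have A: "d n < a" "d n = a - 1 \<Longrightarrow> d (Suc n) = a - 1 \<Longrightarrow> two_zeros d n" for n
      by (auto simp: adm_def d_def[symmetric])
    show "rauzy_admissible a D"
      unfolding rauzy_admissible_def word
    proof (intro conjI allI impI low[rule_format])
      fix i :: int assume i: "2 \<le> i"
      define n where "n = nat (i - 2)"
      have n: "i = int n + 2" using i by (simp add: n_def)
      have "d n < a" by (rule A)
      then show "D i \<in> {0..a - 1}" by (auto simp: d_def n)
      show "D i < a - 1 \<or> (D i = a - 1 \<and> (D (i - 1) < a - 1 \<or> (D (i - 1) = a - 1 \<and> D (i - 2) = 0 \<and> D (i - 3) = 0)))"
      proof (cases n)
        case 0
        then have "D (i - 1) = 0" using low n by simp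
        then show ?thesis using \<open>D i \<in> {0..a - 1}\<close> assms(1) by auto
      next
        case (Suc k)
        have "D i = d (Suc k)" "D (i - 1) = d k" by (simp_all add: d_def n Suc algebra_simps)
        moreover have "two_zeros d k \<longleftrightarrow> D (i - 2) = 0 \<and> D (i - 3) = 0"
          unfolding tz by (simp add: n Suc algebra_simps)
        moreover have "d k < a - 1 \<or> d k = a - 1" "d (Suc k) < a - 1 \<or> d (Suc k) = a - 1"
          using A(1)[of k] A(1)[of "Suc k"] by linarith+
        ultimately show ?thesis using A(2)[of k] by metis
      qed
    qed
  qed
qed

context rauzy
begin

lemma K_Zeros_eq: "K Zeros = ev ` {d. adm a d}"
proof -
  have "run a Zeros = adm a" using run_iff_adm[OF a_ge] by blast
  then show ?thesis unfolding K_def by simp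
qed

lemma rauzy_fractal_eq: "rauzy_fractal a \<alpha> = (\<lambda>z. \<alpha>^2 * z) ` K Zeros"
proof -
  have shift: "(\<Sum>n. of_nat (d n) * \<alpha> ^ (n + 2)) = \<alpha>^2 * ev d" if "adm a d" for d
  proof -
    have "summable (\<lambda>n. of_nat (d n) * \<alpha>^n)"
    proof (rule summable_norm_cancel, rule digit_series_summable)
      show "d n < a" for n using that by (simp add: adm_def)
    qed
    then have "\<alpha>^2 * ev d = (\<Sum>n. \<alpha>^2 * (of_nat (d n) * \<alpha>^n))"
      unfolding ev_def by (rule suminf_mult[symmetric])
    also have "\<dots> = (\<Sum>n. of_nat (d n) * \<alpha> ^ (n + 2))" by (simp add: power_add power2_eq_square mult_ac)
    finally show ?thesis ..
  qed
  have idx: "int (n + 2) = int n + 2" for n by simp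
  show ?thesis
  proof (intro equalityI subsetI)
    fix z assume "z \<in> rauzy_fractal a \<alpha>"
    then obtain D where D: "rauzy_admissible a D" "z = (\<Sum>n. of_nat (D (int (n + 2))) * \<alpha> ^ (n + 2))"
      unfolding rauzy_fractal_def by blast
    define d where "d n = D (int n + 2)" for n
    have "\<forall>i<2. D i = 0" using D(1) by (simp add: rauzy_admissible_def)
    then have "adm a d" using rauzy_admissible_iff[OF a_ge] D(1) unfolding d_def by blast
    have "z = (\<Sum>n. of_nat (d n) * \<alpha> ^ (n + 2))" unfolding D(2) d_def idx ..
    then have "z = \<alpha>^2 * ev d" unfolding shift[OF \<open>adm a d\<close>] .
    with \<open>adm a d\<close> show "z \<in> (\<lambda>z. \<alpha>^2 * z) ` K Zeros" unfolding K_Zeros_eq by blast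
  next
    fix z assume "z \<in> (\<lambda>z. \<alpha>^2 * z) ` K Zeros"
    then obtain d where d: "adm a d" "z = \<alpha>^2 * ev d" unfolding K_Zeros_eq by blast
    define D where "D i = (if i < 2 then 0 else d (nat (i - 2)))" for i :: int
    have Dd: "D (int n + 2) = d n" for n by (simp add: D_def)
    have "\<forall>i<2. D i = 0" by (simp add: D_def)
    then have "rauzy_admissible a D" using rauzy_admissible_iff[OF a_ge] d(1) Dd by simp
    moreover have "z = (\<Sum>n. of_nat (D (int (n + 2))) * \<alpha> ^ (n + 2))"
      unfolding idx Dd shift[OF d(1)] d(2) ..
    ultimately show "z \<in> rauzy_fractal a \<alpha>" unfolding rauzy_fractal_def by blast
  qed
qed

text \<open>The top digit is n div base k and the remainder is expanded recursively. A new violation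
  could only involve the top two digits, where \<open>base_parry\<close> would push n beyond the
  next base element.\<close>

lemma greedy_expansion:
  assumes "0 \<le> n" "n < base k"
  shows "\<exists>d. adm a d \<and> (\<forall>i\<ge>k. d i = 0) \<and> n = (\<Sum>i<k. int (d i) * base i)"
  using assms
proof (induction k arbitrary: n)
  case 0
  then show ?case using a_ge by (intro exI[of _ "\<lambda>_. 0"]) (auto simp: adm_def two_zeros_def)
next
  case (Suc k)
  define q where "q = n div base k"
  define r where "r = n mod base k"
  have r: "0 \<le> r" "r < base k" using base_pos[of k] by (auto simp: r_def)
  have n: "n = q * base k + r" unfolding q_def r_def by (rule div_mult_mod_eq[symmetric])
  have q: "0 \<le> q" "q < int a"
  proof -
    show "0 \<le> q" using Suc.prems(1) base_pos[of k] by (simp add: q_def pos_imp_zdiv_nonneg_iff)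
    have "q * base k < int a * base k" using n r(1) Suc.prems(2) base_le[of k] by linarith
    then show "q < int a" using base_pos[of k] by simp
  qed
  obtain d where d: "adm a d" "\<And>i. i \<ge> k \<Longrightarrow> d i = 0" "r = (\<Sum>i<k. int (d i) * base i)"
    using Suc.IH[OF r] by blast
  define d' where "d' = d(k := nat q)"
  have sum_eq: "n = (\<Sum>i<Suc k. int (d' i) * base i)"
    using n d(3) q(1) by (simp add: d'_def)
  have nonneg: "0 \<le> int (d' i) * base i" for i using base_pos[of i] by simp
  have "two_zeros d' i" if i: "d' i = a - 1" "d' (Suc i) = a - 1" for i
  proof -
    have "Suc i \<le> k"
    proof (rule ccontr)
      assume "\<not> Suc i \<le> k"
      then have "d' (Suc i) = 0" using d(2)[of "Suc i"] by (simp add: d'_def)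
      then show False using i(2) a_ge by simp
    qed
    then consider "Suc i < k" | "k = Suc i" by linarith
    then show ?thesis
    proof cases
      case 1
      then have "d i = a - 1" "d (Suc i) = a - 1" using i by (auto simp: d'_def)
      then have "two_zeros d i" using d(1) by (auto simp: adm_def)
      then show ?thesis using 1 by (simp add: two_zeros_def d'_def)
    next
      case k: 2
      have top: "n = (\<Sum>j<i. int (d' j) * base j) + (int a - 1) * base i + (int a - 1) * base (Suc i)"
        using sum_eq i a_ge unfolding k by (simp add: of_nat_diff)
      have n_lt: "n < base (Suc (Suc i))" using Suc.prems(2) k by simp
      consider "i = 0" | "i = 1" | i' where "i = Suc (Suc i')" by (metis One_nat_def not0_implies_Suc)
      then show ?thesis
      proof cases
        case 1
        then show ?thesis by (simp add: two_zeros_def)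
      next
        case 2
        then have "int (d' 0) < 1" using top n_lt base_parry(2) by simp
        then show ?thesis using 2 by (simp add: two_zeros_def)
      next
        case 3
        \<comment> \<open>Two maximal top digits leave less than \<open>base i'\<close> for the
          rest, so the digits at \<open>i'\<close> and \<open>Suc i'\<close> must vanish.\<close>
        have "(\<Sum>j<i. int (d' j) * base j) < base i'"
          using top n_lt unfolding 3 base_parry(1) by linarith
        moreover have "0 \<le> (\<Sum>j<i'. int (d' j) * base j)" using nonneg by (intro sum_nonneg) auto
        ultimately have lt: "int (d' i') * base i' + int (d' (Suc i')) * base (Suc i') < base i'"
          unfolding 3 by simp
        have le: "base i' \<le> base (Suc i')" using base_double[of i'] base_pos[of i'] by linarith
        have "d' i' = 0"
        proof (rule ccontr)
          assume "d' i' \<noteq> 0"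
          then have "1 * base i' \<le> int (d' i') * base i'" using base_pos[of i'] by (intro mult_right_mono) auto
          then show False using lt nonneg[of "Suc i'"] by linarith
        qed
        moreover have "d' (Suc i') = 0"
        proof (rule ccontr)
          assume "d' (Suc i') \<noteq> 0"
          then have "1 * base (Suc i') \<le> int (d' (Suc i')) * base (Suc i')"
            using base_pos[of "Suc i'"] by (intro mult_right_mono) auto
          then show False using lt le nonneg[of "i'"] by linarith
        qed
        ultimately show ?thesis unfolding 3 two_zeros_Suc by simp
      qed
    qed
  qed
  moreover have "d' i < a" for i using d(1) q by (auto simp: d'_def adm_def)
  ultimately have "adm a d'" by (auto simp: adm_def)
  moreover have "\<forall>i\<ge>Suc k. d' i = 0" using d(2) by (simp add: d'_def)
  ultimately show ?case using sum_eq by blast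
qed

text \<open>Replacing each \<open>base i\<close> by \<alpha>^i in the greedy expansion of n changes
  it by a lattice vector and produces a point of the tile.\<close>

lemma tiles_contain_nonneg:
  assumes "0 \<le> n" "z - of_int n \<in> Lat"
  shows "\<exists>l\<in>Lat. z - l \<in> K Zeros"
proof -
  have "n < base (nat n + 1)" using base_ge[of "nat n + 1"] assms(1) by simp
  then obtain d where d: "adm a d" "\<And>i. i \<ge> nat n + 1 \<Longrightarrow> d i = 0" "n = (\<Sum>i<nat n + 1. int (d i) * base i)"
    using greedy_expansion assms(1) by blast
  have Lat_sum: "(\<Sum>i<k. of_int (int (d i)) * (of_int (-1) * (\<alpha>^i - of_int (base i)))) \<in> Lat" for k
    by (induction k) (auto intro!: Lat_closed power_cong_base simp del: of_int_of_nat_eq of_int_minus)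
  have "ev d = (\<Sum>i<nat n + 1. of_nat (d i) * \<alpha>^i)"
    unfolding ev_def using d(2) by (intro suminf_finite) auto
  then have "of_int n - ev d = (\<Sum>i<nat n + 1. of_int (int (d i)) * (of_int (-1) * (\<alpha>^i - of_int (base i))))"
    by (subst (1) d(3)) (simp add: sum_subtractf algebra_simps)
  then have "of_int n - ev d \<in> Lat" by (simp only: Lat_sum)
  then have "(z - of_int n) + (of_int n - ev d) \<in> Lat" by (intro Lat_closed assms(2))
  moreover have "ev d \<in> K Zeros" using d(1) by (auto simp: K_Zeros_eq)
  ultimately show ?thesis by (intro bexI[of _ "(z - of_int n) + (of_int n - ev d)"]) auto
qed

text \<open>Integer combinations of \<alpha>^k and \<alpha>^(k+1) approximate z up to 2 |\<alpha>|^k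
  and are congruent to integers modulo the lattice.\<close>

lemma tiles_dense:
  assumes "0 < \<epsilon>"
  shows "\<exists>w. norm (z - w) < \<epsilon> \<and> (\<exists>l\<in>Lat. w - l \<in> K Zeros)"
proof -
  have "(\<lambda>k. norm \<alpha> ^ k * 3) \<longlonglongrightarrow> 0" using norm_alpha by (intro tendsto_mult_left_zero LIMSEQ_power_zero) simp
  then have "\<forall>\<^sub>F k in sequentially. norm \<alpha> ^ k * 3 < \<epsilon>" using assms by (rule order_tendstoD)
  then obtain k where k: "norm \<alpha> ^ k * 3 < \<epsilon>" by (auto simp: eventually_sequentially)
  define m where "m = \<lfloor>Xc (z / \<alpha>^k)\<rfloor>"
  define l where "l = \<lfloor>Yc (z / \<alpha>^k)\<rfloor>"
  \<comment> \<open>The extra \<alpha>^j moves w by at most |\<alpha>|^k, while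
    \<open>base j \<ge> j\<close> makes the congruent integer nonnegative.\<close>
  define j where "j = k + nat \<bar>m * base k + l * base (Suc k)\<bar>"
  define w where "w = of_int m * \<alpha>^k + of_int l * \<alpha>^Suc k + \<alpha>^j"
  define n where "n = m * base k + l * base (Suc k) + base j"
  have "0 \<le> n" using base_ge[of j] by (simp add: n_def j_def)
  have "w - of_int n = of_int m * (\<alpha>^k - of_int (base k)) + of_int l * (\<alpha>^Suc k - of_int (base (Suc k))) +
      (\<alpha>^j - of_int (base j))"
    by (simp add: w_def n_def algebra_simps)
  also have "\<dots> \<in> Lat" by (intro Lat_closed power_cong_base)
  finally have "w - of_int n \<in> Lat" .
  have "z - w = \<alpha>^k * (z / \<alpha>^k - of_int m - of_int l * \<alpha>) - \<alpha>^j"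
    by (simp add: w_def algebra_simps)
  also have "z / \<alpha>^k - of_int m - of_int l * \<alpha> =
      of_real (Xc (z / \<alpha>^k) - of_int m) + of_real (Yc (z / \<alpha>^k) - of_int l) * \<alpha>"
    by (subst coords) (simp add: algebra_simps)
  finally have "norm (z - w) \<le> norm \<alpha>^k * norm (of_real (Xc (z / \<alpha>^k) - of_int m) + of_real (Yc (z / \<alpha>^k) - of_int l) * \<alpha>) + norm \<alpha>^j"
    by (metis norm_mult norm_power norm_triangle_ineq4)
  also have "norm (of_real (Xc (z / \<alpha>^k) - of_int m) + of_real (Yc (z / \<alpha>^k) - of_int l) * \<alpha>) \<le> 1 + 1 * 1"
  proof (rule order_trans[OF norm_triangle_ineq])
    have "\<bar>Xc (z / \<alpha>^k) - of_int m\<bar> \<le> 1" "\<bar>Yc (z / \<alpha>^k) - of_int l\<bar> \<le> 1"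
      unfolding m_def l_def by linarith+
    then show "norm (of_real (Xc (z / \<alpha>^k) - of_int m) :: complex) + norm (of_real (Yc (z / \<alpha>^k) - of_int l) * \<alpha>) \<le> 1 + 1 * 1"
      unfolding norm_mult norm_of_real using norm_alpha by (intro add_mono mult_mono) auto
  qed
  also have "norm \<alpha>^j \<le> norm \<alpha>^k" using norm_alpha by (intro power_decreasing) (auto simp: j_def)
  finally have "norm (z - w) < \<epsilon>" using k by (simp add: mult_left_mono)
  then show ?thesis using tiles_contain_nonneg[OF \<open>0 \<le> n\<close> \<open>w - of_int n \<in> Lat\<close>] by blast
qed

text \<open>Only finitely many translates meet a unit ball around z, and their union is closed, so
  density already gives covering.\<close>

lemma tiles_cover: "\<exists>l\<in>Lat. z - l \<in> K Zeros"
proof (rule ccontr)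
  assume no: "\<not> (\<exists>l\<in>Lat. z - l \<in> K Zeros)"
  define F where "F = {l \<in> Lat. \<exists>x\<in>K Zeros. x + l \<in> ball z 1}"
  define G where "G = (\<Union>l\<in>F. (+) l ` K Zeros)"
  have "finite F" unfolding F_def by (intro Lat_locally_finite) simp
  then have "closed G" unfolding G_def by (intro closed_UN ballI closed_translation K_closed)
  moreover have "z \<notin> G" using no by (auto simp: G_def F_def)
  ultimately obtain \<epsilon> where \<epsilon>: "0 < \<epsilon>" "ball z \<epsilon> \<inter> G = {}"
    by (metis ComplI Diff_disjoint Compl_eq_Diff_UNIV open_Compl openE disjoint_eq_subset_Compl)
  then obtain w l where w: "norm (z - w) < min 1 \<epsilon>" "l \<in> Lat" "w - l \<in> K Zeros"
    using tiles_dense[of "min 1 \<epsilon>" z] by auto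
  then have "l \<in> F" by (auto simp: F_def dist_norm intro!: bexI[of _ "w - l"])
  then have "w \<in> G" unfolding G_def using w(3) by (intro UN_I[of l]) (auto intro!: image_eqI[of _ _ "w - l"])
  moreover have "w \<in> ball z \<epsilon>" using w(1) by (simp add: dist_norm)
  ultimately show False using \<epsilon>(2) by blast
qed

end

section \<open>A tile bounded by a Jordan curve\<close>

text \<open>The tile minus the loop is relatively open and closed in the complement of the loop, hence a union of
  Jordan components; it misses the unbounded one, and it is nonempty because finitely many
  translates of a set without interior cannot cover a disk.\<close>

lemma frontier_of_tile_bounded_by_loop:
  fixes T L :: "complex set"
  assumes "compact T"
    and cover: "\<And>z. \<exists>l\<in>L. z - l \<in> T"
    and locfin: "\<And>S. bounded S \<Longrightarrow> finite {l \<in> L. \<exists>x\<in>T. x + l \<in> S}"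
    and overlap: "\<And>l x. l \<in> L \<Longrightarrow> l \<noteq> 0 \<Longrightarrow> x \<in> T \<Longrightarrow> x - l \<in> T \<Longrightarrow> x \<in> path_image g"
    and g: "simple_path g" "pathfinish g = pathstart g"
  shows "frontier T = path_image g"
proof -
  define J where "J = path_image g"
  have J: "inside J \<noteq> {}" "open (inside J)" "connected (inside J)" "outside J \<noteq> {}" "open (outside J)"
    "connected (outside J)" "\<not> bounded (outside J)" "inside J \<inter> outside J = {}"
    "inside J \<union> outside J = - J" "frontier (inside J) = J" "frontier (outside J) = J"
    using Jordan_inside_outside[OF g] unfolding J_def by auto
  have "closed T" "bounded T" using \<open>compact T\<close> by (auto simp: compact_eq_bounded_closed)
  define F where "F z = {l \<in> L. \<exists>x\<in>T. x + l \<in> ball z 1}" for z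
  have F: "finite (F z)" for z unfolding F_def by (intro locfin) simp
  \<comment> \<open>Off the loop z lies in no other translate; finitely many closed ones are near,
    so a small ball avoids them all and is covered by T alone.\<close>
  have int: "z \<in> interior T" if z: "z \<in> T" "z \<notin> J" for z
  proof -
    define G where "G = (\<Union>l\<in>F z - {0}. (+) l ` T)"
    have "closed G" unfolding G_def using F \<open>closed T\<close> by (intro closed_UN ballI closed_translation) auto
    have "z \<notin> G"
    proof
      assume "z \<in> G"
      then obtain l x where "l \<in> L" "l \<noteq> 0" "x \<in> T" "z = l + x" by (auto simp: G_def F_def)
      then show False using overlap[of l z] z by (simp add: J_def)
    qed
    then obtain \<epsilon> where \<epsilon>: "0 < \<epsilon>" "ball z \<epsilon> \<subseteq> - G"
      using \<open>closed G\<close> open_contains_ball[of "- G"] by auto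
    have "ball z (min 1 \<epsilon>) \<subseteq> T"
    proof
      fix y assume y: "y \<in> ball z (min 1 \<epsilon>)"
      obtain l where l: "l \<in> L" "y - l \<in> T" using cover by blast
      have "l \<in> F z" using l y by (auto simp: F_def intro!: bexI[of _ "y - l"])
      have "y \<notin> G" using \<epsilon>(2) y by auto
      then have "l = 0" using \<open>l \<in> F z\<close> l(2) by (force simp: G_def intro: image_eqI[of _ _ "y - l"])
      then show "y \<in> T" using l(2) by simp
    qed
    then show ?thesis using \<epsilon>(1) by (auto simp: mem_interior intro!: exI[of _ "min 1 \<epsilon>"])
  qed
  have dich: "A \<subseteq> T \<or> A \<inter> T = {}" if A: "connected A" "A \<inter> J = {}" for A
  proof -
    have "A \<subseteq> interior T \<union> - T" using int A(2) by blast
    moreover have "interior T \<inter> - T \<inter> A = {}" using interior_subset by blast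
    ultimately have "interior T \<inter> A = {} \<or> - T \<inter> A = {}"
      using connectedD[OF A(1) open_interior open_Compl[OF \<open>closed T\<close>]] by blast
    then show ?thesis using int A(2) by blast
  qed
  have out: "outside J \<inter> T = {}"
    using dich[OF J(6)] J(7,9) bounded_subset[OF \<open>bounded T\<close>] by blast
  have "inside J \<subseteq> T"
  proof (rule ccontr)
    assume "\<not> inside J \<subseteq> T"
    then have "inside J \<inter> T = {}" using dich[OF J(3)] J(9) by blast
    then have "T \<subseteq> J" using out J(9) by blast
    \<comment> \<open>Each point of J is a limit of points inside J, which do not belong to
      T.\<close>
    have "interior T = {}"
    proof (rule ccontr)
      assume "interior T \<noteq> {}"
      then obtain z where z: "z \<in> interior T" by blast
      then have "z \<in> closure (inside J)"
        using \<open>T \<subseteq> J\<close> J(10) interior_subset[of T] by (auto simp: frontier_def)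
      then have "interior T \<inter> inside J \<noteq> {}"
        using z open_Int_closure_eq_empty[OF open_interior] by blast
      then show False using \<open>inside J \<inter> T = {}\<close> interior_subset by blast
    qed
    then have tr: "interior ((+) l ` T) = {}" for l by (simp add: interior_translation)
    have "interior (\<Union>l\<in>E. (+) l ` T) = {}" if "finite E" for E
      using that
    proof induction
      case (insert l E)
      have "interior ((+) l ` T \<union> (\<Union>l\<in>E. (+) l ` T)) = interior ((+) l ` T)"
        using \<open>closed T\<close> insert.IH by (intro interior_closed_Un_empty_interior closed_translation)
      then show ?case using tr by simp
    qed simp
    then have "interior (\<Union>l\<in>F 0. (+) l ` T) = {}" using F by blast
    moreover have "ball 0 1 \<subseteq> (\<Union>l\<in>F 0. (+) l ` T)"
    proof
      fix y :: complex assume y: "y \<in> ball 0 1"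
      obtain l where l: "l \<in> L" "y - l \<in> T" using cover by blast
      then have "l \<in> F 0" using y by (auto simp: F_def intro!: bexI[of _ "y - l"])
      then show "y \<in> (\<Union>l\<in>F 0. (+) l ` T)"
        using l(2) by (intro UN_I[of l]) (auto intro!: image_eqI[of _ _ "y - l"])
    qed
    then have "ball 0 1 \<subseteq> interior (\<Union>l\<in>F 0. (+) l ` T)" by (intro interior_maximal) auto
    ultimately show False by simp
  qed
  then have "closure (inside J) \<subseteq> T" using \<open>closed T\<close> by (rule closure_minimal)
  then have "J \<subseteq> T" using J(10) by (auto simp: frontier_def)
  have "J \<inter> interior T = {}"
  proof (rule ccontr)
    assume "J \<inter> interior T \<noteq> {}"
    then obtain z where "z \<in> interior T" "z \<in> closure (outside J)"
      using J(11) by (auto simp: frontier_def)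
    then have "interior T \<inter> outside J \<noteq> {}"
      using open_Int_closure_eq_empty[OF open_interior] by blast
    then show False using out interior_subset by blast
  qed
  moreover have "T - J \<subseteq> interior T" using int by blast
  ultimately have "T - interior T = J" using \<open>J \<subseteq> T\<close> interior_subset by blast
  then show ?thesis using \<open>closed T\<close> by (simp add: frontier_def J_def)
qed

lemma arc_affine:
  fixes p :: "real \<Rightarrow> complex"
  assumes "arc p" "m \<noteq> 0"
  shows "arc (\<lambda>t. m * p t + b)"
proof -
  have "path (\<lambda>t. m * p t + b)"
    using assms(1) unfolding arc_def path_def by (intro continuous_intros) auto
  moreover have "inj_on (\<lambda>t. m * p t + b) {0..1}"
    using assms by (auto simp: arc_def inj_on_def)
  ultimately show ?thesis by (simp add: arc_def)
qed

section \<open>The boundary loop and the frontier of the fractal\<close>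

context rauzy
begin

text \<open>The loop runs along P from \<open>lft\<close> to \<open>rgt\<close>, back along \<alpha>
  P + h to \<open>rgt + c\<close>, back along P + c to \<open>lft + c\<close>, and along \<alpha> P
  to \<open>lft\<close>. Two arcs of two sides each are joined; by \<open>curve_meets\<close> they
  share only \<open>lft\<close> and \<open>rgt + c\<close>.\<close>

lemma boundary_loop:
  obtains g where "simple_path g" "pathfinish g = pathstart g" "path_image g = boundary"
proof -
  define p where "p t = curve (len * t)" for t
  have img: "(*) len ` {0..1} = {0..len}"
    using len_ge image_mult_atLeastAtMost[of len 0 1] by simp
  have "continuous_on {0..1} p"
    unfolding p_def using img by (intro continuous_on_compose2[OF continuous_curve] continuous_intros) auto
  moreover have "inj_on p {0..1}"
  proof (rule inj_onI)
    fix x y :: real assume xy: "x \<in> {0..1}" "y \<in> {0..1}" "p x = p y"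
    then have "len * x = len * y"
      using img by (intro inj_onD[OF curve_inj]) (auto simp only: p_def)
    then show "x = y" using len_ge by simp
  qed
  ultimately have p: "arc p" by (simp add: arc_def path_def)
  have pimg: "path_image p = curve ` {0..len}"
    unfolding path_image_def p_def img[symmetric] image_image ..
  define q1 where "q1 t = \<alpha> * p t + h" for t
  define q2 where "q2 t = 1 * p t + c" for t
  define q3 where "q3 t = \<alpha> * p t + 0" for t
  have arcs: "arc q1" "arc q2" "arc q3"
    unfolding q1_def q2_def q3_def by (intro arc_affine p; simp)+
  have qimg: "path_image q1 = (\<lambda>z. \<alpha> * z + h) ` curve ` {0..len}"
    "path_image q2 = (\<lambda>z. z + c) ` curve ` {0..len}"
    "path_image q3 = (\<lambda>z. \<alpha> * z) ` curve ` {0..len}"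
    unfolding pimg[symmetric] by (auto simp: path_image_def q1_def q2_def q3_def image_image)
  have "p 0 = lft" "p 1 = rgt" by (simp_all add: p_def curve_ends)
  moreover have corners: "\<alpha> * rgt = lft" "lft + c + h = rgt + c" "lft + h = rgt"
    by (simp add: lft_def) (simp_all add: rgt_eq)
  ultimately have ends: "pathstart p = lft" "pathfinish p = rgt"
    "pathstart q1 = rgt + c" "pathfinish q1 = rgt" "pathstart q2 = lft + c" "pathfinish q2 = rgt + c"
    "pathstart q3 = lft + c" "pathfinish q3 = lft"
    by (simp_all add: pathstart_def pathfinish_def q1_def q2_def q3_def alpha_lft corners)
  have "arc (p +++ reversepath q1)"
  proof (rule arc_join)
    show "path_image p \<inter> path_image (reversepath q1) \<subseteq> {pathstart (reversepath q1)}"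
      using curve_meets(3) by (auto simp: pimg qimg ends)
  qed (simp_all add: p arcs ends arc_reversepath)
  moreover have "arc (reversepath q2 +++ q3)"
  proof (rule arc_join)
    show "path_image (reversepath q2) \<inter> path_image q3 \<subseteq> {pathstart q3}"
    proof
      fix z assume "z \<in> path_image (reversepath q2) \<inter> path_image q3"
      then obtain u w where "u \<in> {0..len}" "w \<in> {0..len}" "z = curve u + c" "z = \<alpha> * curve w"
        by (auto simp: qimg)
      then show "z \<in> {pathstart q3}" using curve_meets(2)[of u w] by (simp add: ends)
    qed
  qed (simp_all add: arcs ends arc_reversepath)
  moreover have "path_image (p +++ reversepath q1) \<inter> path_image (reversepath q2 +++ q3) \<subseteq>
      {pathstart (p +++ reversepath q1), pathstart (reversepath q2 +++ q3)}"
  proof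
    fix z assume "z \<in> path_image (p +++ reversepath q1) \<inter> path_image (reversepath q2 +++ q3)"
    then obtain u w where uw: "u \<in> {0..len}" "w \<in> {0..len}" "z = curve u \<or> z = \<alpha> * curve u + h"
      "z = curve w + c \<or> z = \<alpha> * curve w"
      by (auto simp: path_image_join ends qimg pimg)
    have "z = lft \<or> z = rgt + c"
      using uw(3,4) curve_meets(1)[OF uw(1,2)] curve_meets(5)[OF uw(1,2)] curve_meets(4)[OF uw(2,1)]
        curve_meets(6)[OF uw(2,1)] by auto
    then show "z \<in> {pathstart (p +++ reversepath q1), pathstart (reversepath q2 +++ q3)}"
      by (simp add: ends)
  qed
  ultimately have "simple_path ((p +++ reversepath q1) +++ (reversepath q2 +++ q3))"
    by (intro simple_path_join_loop) (simp_all add: ends)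
  moreover have "path_image ((p +++ reversepath q1) +++ (reversepath q2 +++ q3)) = boundary"
    by (auto simp: path_image_join ends pimg qimg boundary_def)
  ultimately show thesis by (intro that) (simp_all add: ends)
qed

lemma frontier_tile: "frontier (K Zeros) = boundary"
proof -
  obtain g where g: "simple_path g" "pathfinish g = pathstart g" "path_image g = boundary"
    by (rule boundary_loop)
  have "frontier (K Zeros) = path_image g"
  proof (rule frontier_of_tile_bounded_by_loop[OF K_compact tiles_cover Lat_locally_finite _ g(1,2)])
    fix l x assume l: "l \<in> Lat" "l \<noteq> 0" and x: "x \<in> K Zeros" "x - l \<in> K Zeros"
    obtain m n where "l = tau m n" using l(1) by (auto simp: Lat_def)
    then show "x \<in> path_image g"
      unfolding g(3) using overlap_boundary[OF x(1,2), of m n] l(2) by simp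
  qed
  then show ?thesis by (simp add: g(3))
qed

lemma frontier_rauzy_fractal: "frontier (rauzy_fractal a \<alpha>) homeomorphic sphere (0 :: complex) 1"
proof -
  define f where "f = (\<lambda>z. \<alpha>^2 * z)"
  have f: "linear f" "inj f"
    unfolding f_def by (rule bounded_linear.linear[OF bounded_linear_mult_right]) (simp add: inj_def)
  obtain g where g: "simple_path g" "pathfinish g = pathstart g" "path_image g = boundary"
    by (rule boundary_loop)
  have "frontier (rauzy_fractal a \<alpha>) = f ` boundary"
    unfolding rauzy_fractal_eq f_def[symmetric] frontier_tile[symmetric] frontier_def
    using f by (simp add: closure_injective_linear_image interior_injective_linear_image image_set_diff)
  also have "f ` boundary homeomorphic boundary"
    using linear_homeomorphic_image[OF f] homeomorphic_sym by blast
  also have "boundary homeomorphic sphere (0 :: complex) 1"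
    using homeomorphic_simple_path_image_circle[OF g(1,2)] by (simp add: g(3))
  finally show ?thesis .
qed

end

theorem theorem1p4:
  fixes a :: nat and \<beta> :: real and \<alpha> :: complex
  assumes "a \<ge> 3"
    and "rauzy_roots a \<beta> \<alpha>"
  shows "frontier (rauzy_fractal a \<alpha>) homeomorphic sphere (0 :: complex) 1"
proof -
  interpret rauzy a \<beta> \<alpha> by unfold_locales (rule assms)+
  show ?thesis by (rule frontier_rauzy_fractal)
qed

end
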